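(* Let $k$ be a field, let $\mathcal{C},\mathcal{D}$ be finite categories, let $\boldsymbol{s}:\mathcal{D}\to\mathcal{C}$ be a covariant functor that is injective on objects and surjective on morphisms, and let $(C,\sigma)$ be an interior $k\mathcal{D}$-algebra. (i) Then $\mathrm{IndP}^{\mathcal{C}}_{\boldsymbol{s},\mathcal{D}}(C)$ is a $k$-algebra. (ii) If $[f]=\mathrm{Id}_y\circ f=f\circ\mathrm{Id}_x$ for all $x,y\in\mathrm{Ob}\,\mathcal{D}$ and all $f\in\mathrm{Hom}_{\mathcal{D}}(x,y)$, then $\mathrm{IndP}^{\mathcal{C}}_{\boldsymbol{s},\mathcal{D}}(C)$ is an interior $k\mathcal{C}$-algebra.
   Context: Conventions. A finite category is one with finitely many morphisms. For a morphism $f:x\to y$ write $\mathrm{d}(f)=x$, $\mathrm{c}(f)=y$. A $k$-algebra is a unital associative $k$-algebra, and homomorphisms are unital. The category algebra $k\mathcal{D}$ has $k$-basis $\mathrm{Mor}\,\mathcal{D}$, with $g\cdot f=g\circ f$ if $\mathrm{d}(g)=\mathrm{c}(f)$ and $0$ otherwise; its identity is $\sum_x1_x$. For a $k$-algebra $A$, an interior $A$-algebra $(C,\sigma)$ is a $k$-algebra $C$ together with a $k$-algebra homomorphism $\sigma:A\to C$. For $f\in\mathrm{Mor}\,\mathcal{D}$ put $[f]=\{g\in\mathrm{Mor}\,\mathcal{D}\mid\boldsymbol{s}(g)=\boldsymbol{s}(f)\}$. The functor $\boldsymbol{s}$ is bijective on objects; for $x\in\mathrm{Ob}\,\mathcal{D}$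 put $\mathrm{Id}_x=[1_x]=\{f\in\mathrm{Mor}\,\mathcal{D}\mid\boldsymbol{s}(f)=1_{\boldsymbol{s}(x)}\}$. Moreover $\mathrm{Id}_y\circ f=\{g\circ f\mid g\in\mathrm{Id}_y\}$ and $f\circ\mathrm{Id}_x=\{f\circ g\mid g\in\mathrm{Id}_x\}$. Let $\mathcal{S}=\{\sum_{x\in\mathrm{Ob}\,\mathcal{D}}f_x\mid f_x\in\mathrm{Id}_x\}\subseteq k\mathcal{D}$, a submonoid of $(k\mathcal{D},\cdot)$; let $k\mathcal{S}$ be the $k$-subalgebra of $k\mathcal{D}$ spanned by $\mathcal{S}$, and let $\varepsilon:k\mathcal{S}\to k$ be the augmentation, $\varepsilon(s)=1$ for $s\in\mathcal{S}$. Surjective Puig's induction. View $k$ as a right $k\mathcal{S}$-module via $\varepsilon$ and $C$ as a $(k\mathcal{S},k\mathcal{S})$-bimodule via $\sigma$; then $$\mathrm{IndP}^{\mathcal{C}}_{\boldsymbol{s},\mathcal{D}}(C)=(k\otimes_{k\mathcal{S}}C)^{\mathcal{S}}=\{z\in k\otimes_{k\mathcal{S}}C\mid z\cdot s=z\ \ \forall s\in\mathcal{S}\},\qquad (a\otimes c)\cdot s=a\otimes c\,\sigma(s).$$ The multiplication meant in (i) is the pointwise one, $(a_1\otimes c_1)(a_2\otimes c_2)=a_1a_2\otimes c_1c_2$, with identity $1\otimes1_C$. The interior structure meant in (ii) is the map $k\mathcal{C}\to\mathrm{IndP}^{\mathcal{C}}_{\boldsymbol{s},\mathcal{D}}(C)$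 given on $f'\in\mathrm{Mor}\,\mathcal{C}$ by $f'\mapsto1\otimes\sigma(f)$, where $f\in\mathrm{Mor}\,\mathcal{D}$ is any morphism with $\boldsymbol{s}(f)=f'$. *)

theory Defs
  imports "HOL-Algebra.Module" "HOL-Algebra.AbelCoset"
begin

section \<open>Finite categories and functors\<close>

record ('o, 'm) category =
  Ob :: "'o set"
  Mor :: "'m set"
  src :: "'m \<Rightarrow> 'o"
  tgt :: "'m \<Rightarrow> 'o"
  idt :: "'o \<Rightarrow> 'm"
  cmp :: "'m \<Rightarrow> 'm \<Rightarrow> 'm"

text \<open>\<open>cmp C g f\<close> is the composite \<open>g \<circ> f\<close> (first \<open>f\<close>, then \<open>g\<close>); its value is
  unconstrained unless \<open>src C g = tgt C f\<close>.\<close>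

definition is_category :: "('o, 'm) category \<Rightarrow> bool" where
  "is_category C \<longleftrightarrow>
     (\<forall>f\<in>Mor C. src C f \<in> Ob C \<and> tgt C f \<in> Ob C) \<and>
     (\<forall>x\<in>Ob C. idt C x \<in> Mor C \<and> src C (idt C x) = x \<and> tgt C (idt C x) = x) \<and>
     (\<forall>f\<in>Mor C. \<forall>g\<in>Mor C. src C g = tgt C f \<longrightarrow>
        cmp C g f \<in> Mor C \<and> src C (cmp C g f) = src C f \<and> tgt C (cmp C g f) = tgt C g) \<and>
     (\<forall>f\<in>Mor C. cmp C f (idt C (src C f)) = f \<and> cmp C (idt C (tgt C f)) f = f) \<and>
     (\<forall>f\<in>Mor C. \<forall>g\<in>Mor C. \<forall>h\<in>Mor C. src C g = tgt C f \<longrightarrow> src C h = tgt C g \<longrightarrow>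
        cmp C h (cmp C g f) = cmp C (cmp C h g) f)"

definition finite_category :: "('o, 'm) category \<Rightarrow> bool" where
  "finite_category C \<longleftrightarrow> is_category C \<and> finite (Mor C)"

definition hom_set :: "('o, 'm) category \<Rightarrow> 'o \<Rightarrow> 'o \<Rightarrow> 'm set" where
  "hom_set C x y = {f \<in> Mor C. src C f = x \<and> tgt C f = y}"

definition is_functor ::
  "('o, 'm) category \<Rightarrow> ('p, 'n) category \<Rightarrow> ('o \<Rightarrow> 'p) \<Rightarrow> ('m \<Rightarrow> 'n) \<Rightarrow> bool" where
  "is_functor D C so sm \<longleftrightarrow>
     (\<forall>x\<in>Ob D. so x \<in> Ob C \<and> sm (idt D x) = idt C (so x)) \<and>
     (\<forall>f\<in>Mor D. sm f \<in> Mor C \<and> src C (sm f) = so (src D f) \<and> tgt C (sm f) = so (tgt D f)) \<and>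
     (\<forall>f\<in>Mor D. \<forall>g\<in>Mor D. src D g = tgt D f \<longrightarrow> sm (cmp D g f) = cmp C (sm g) (sm f))"


section \<open>Algebras over a field\<close>

text \<open>The locale \<open>algebra\<close> of the library asks for commutative multiplication.\<close>

locale assoc_algebra = K?: field K + module K A + A?: ring A
  for K (structure) and A (structure) +
  assumes smult_mult_left:
      "\<lbrakk>a \<in> carrier K; x \<in> carrier A; y \<in> carrier A\<rbrakk> \<Longrightarrow>
       (a \<odot>\<^bsub>A\<^esub> x) \<otimes>\<^bsub>A\<^esub> y = a \<odot>\<^bsub>A\<^esub> (x \<otimes>\<^bsub>A\<^esub> y)"
    and smult_mult_right:
      "\<lbrakk>a \<in> carrier K; x \<in> carrier A; y \<in> carrier A\<rbrakk> \<Longrightarrow>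
       x \<otimes>\<^bsub>A\<^esub> (a \<odot>\<^bsub>A\<^esub> y) = a \<odot>\<^bsub>A\<^esub> (x \<otimes>\<^bsub>A\<^esub> y)"

definition algebra_hom ::
  "('k, 'e) ring_scheme \<Rightarrow> ('k, 'a, 'f) module_scheme \<Rightarrow> ('k, 'b, 'g) module_scheme \<Rightarrow> ('a \<Rightarrow> 'b) set"
  where
  "algebra_hom K A B = {h \<in> ring_hom A B.
     \<forall>r\<in>carrier K. \<forall>x\<in>carrier A. h (r \<odot>\<^bsub>A\<^esub> x) = r \<odot>\<^bsub>B\<^esub> h x}"

definition interior_algebra ::
  "('k, 'e) ring_scheme \<Rightarrow> ('k, 'a, 'f) module_scheme \<Rightarrow> ('k, 'b, 'g) module_scheme \<Rightarrow> ('a \<Rightarrow> 'b) \<Rightarrow> bool"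
  where
  "interior_algebra K A B \<sigma> \<longleftrightarrow> assoc_algebra K B \<and> \<sigma> \<in> algebra_hom K A B"


section \<open>Free modules, spans, quotients and tensor products\<close>

text \<open>The fields \<open>mult\<close> and \<open>one\<close> of a record that serves as a mere module are irrelevant.\<close>

definition basis_elt :: "('k, 'e) ring_scheme \<Rightarrow> 'x \<Rightarrow> 'x \<Rightarrow> 'k" where
  "basis_elt K x = (\<lambda>y. if y = x then \<one>\<^bsub>K\<^esub> else \<zero>\<^bsub>K\<^esub>)"

definition free_module :: "('k, 'e) ring_scheme \<Rightarrow> 'x set \<Rightarrow> ('k, 'x \<Rightarrow> 'k) module" where
  "free_module K B =
     \<lparr>carrier = {a. (\<forall>x. a x \<in> carrier K) \<and> {x. a x \<noteq> \<zero>\<^bsub>K\<^esub>} \<subseteq> B \<and> finite {x. a x \<noteq> \<zero>\<^bsub>K\<^esub>}},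
      mult = undefined, one = undefined,
      zero = (\<lambda>x. \<zero>\<^bsub>K\<^esub>), add = (\<lambda>a b x. a x \<oplus>\<^bsub>K\<^esub> b x),
      smult = (\<lambda>r a x. r \<otimes>\<^bsub>K\<^esub> a x)\<rparr>"

definition regular_module :: "('k, 'e) ring_scheme \<Rightarrow> ('k, 'k) module" where
  "regular_module K =
     \<lparr>carrier = carrier K, mult = mult K, one = one K, zero = zero K, add = add K,
      smult = mult K\<rparr>"

definition linear_span ::
  "('k, 'e) ring_scheme \<Rightarrow> ('k, 'a, 'f) module_scheme \<Rightarrow> 'a set \<Rightarrow> 'a set" where
  "linear_span K M Y = \<Inter> {H. submodule H K M \<and> Y \<subseteq> H}"

definition quotient_module ::
  "('k, 'a, 'f) module_scheme \<Rightarrow> 'a set \<Rightarrow> ('k, 'a set) module" where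
  "quotient_module M N =
     \<lparr>carrier = a_rcosets\<^bsub>M\<^esub> N, mult = undefined, one = undefined,
      zero = N, add = set_add M,
      smult = (\<lambda>r Z. \<Union>x\<in>Z. N +>\<^bsub>M\<^esub> (r \<odot>\<^bsub>M\<^esub> x))\<rparr>"

text \<open>The tensor product \<open>M \<otimes>\<^bsub>R\<^esub> N\<close> over a \<open>K\<close>-algebra with carrier \<open>R\<close>, where the right
  action of \<open>R\<close> on \<open>M\<close> is \<open>ra\<close> and the left action of \<open>R\<close> on \<open>N\<close> is \<open>la\<close>: the free
  \<open>K\<close>-module on \<open>M \<times> N\<close> modulo \<open>K\<close>-bilinearity and \<open>m r \<otimes> n = m \<otimes> r n\<close>.\<close>

definition tensor_relations ::
  "('k, 'e) ring_scheme \<Rightarrow> 'r set \<Rightarrow> ('k, 'm, 'f) module_scheme \<Rightarrow> ('m \<Rightarrow> 'r \<Rightarrow> 'm) \<Rightarrow>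
   ('k, 'n, 'g) module_scheme \<Rightarrow> ('r \<Rightarrow> 'n \<Rightarrow> 'n) \<Rightarrow> ('m \<times> 'n \<Rightarrow> 'k) set" where
  "tensor_relations K R M ra N la =
    (let F = free_module K (carrier M \<times> carrier N); e = basis_elt K in
       {e (m \<oplus>\<^bsub>M\<^esub> m', n) \<ominus>\<^bsub>F\<^esub> (e (m, n) \<oplus>\<^bsub>F\<^esub> e (m', n)) | m m' n.
          m \<in> carrier M \<and> m' \<in> carrier M \<and> n \<in> carrier N}
     \<union> {e (m, n \<oplus>\<^bsub>N\<^esub> n') \<ominus>\<^bsub>F\<^esub> (e (m, n) \<oplus>\<^bsub>F\<^esub> e (m, n')) | m n n'.
          m \<in> carrier M \<and> n \<in> carrier N \<and> n' \<in> carrier N}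
     \<union> {e (a \<odot>\<^bsub>M\<^esub> m, n) \<ominus>\<^bsub>F\<^esub> (a \<odot>\<^bsub>F\<^esub> e (m, n)) | a m n.
          a \<in> carrier K \<and> m \<in> carrier M \<and> n \<in> carrier N}
     \<union> {e (m, a \<odot>\<^bsub>N\<^esub> n) \<ominus>\<^bsub>F\<^esub> (a \<odot>\<^bsub>F\<^esub> e (m, n)) | a m n.
          a \<in> carrier K \<and> m \<in> carrier M \<and> n \<in> carrier N}
     \<union> {e (ra m r, n) \<ominus>\<^bsub>F\<^esub> e (m, la r n) | m r n.
          m \<in> carrier M \<and> r \<in> R \<and> n \<in> carrier N})"

definition tensor_module ::
  "('k, 'e) ring_scheme \<Rightarrow> 'r set \<Rightarrow> ('k, 'm, 'f) module_scheme \<Rightarrow> ('m \<Rightarrow> 'r \<Rightarrow> 'm) \<Rightarrow>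
   ('k, 'n, 'g) module_scheme \<Rightarrow> ('r \<Rightarrow> 'n \<Rightarrow> 'n) \<Rightarrow> ('k, ('m \<times> 'n \<Rightarrow> 'k) set) module" where
  "tensor_module K R M ra N la =
    (let F = free_module K (carrier M \<times> carrier N)
     in quotient_module F (linear_span K F (tensor_relations K R M ra N la)))"

definition tensor_elt ::
  "('k, 'e) ring_scheme \<Rightarrow> 'r set \<Rightarrow> ('k, 'm, 'f) module_scheme \<Rightarrow> ('m \<Rightarrow> 'r \<Rightarrow> 'm) \<Rightarrow>
   ('k, 'n, 'g) module_scheme \<Rightarrow> ('r \<Rightarrow> 'n \<Rightarrow> 'n) \<Rightarrow> 'm \<Rightarrow> 'n \<Rightarrow> ('m \<times> 'n \<Rightarrow> 'k) set" where
  "tensor_elt K R M ra N la m n =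
    (let F = free_module K (carrier M \<times> carrier N)
     in linear_span K F (tensor_relations K R M ra N la) +>\<^bsub>F\<^esub> basis_elt K (m, n))"


section \<open>Category algebras\<close>

text \<open>The multiplication is the bilinear extension of \<open>g \<cdot> f = g \<circ> f\<close> if
  \<open>src D g = tgt D f\<close>, and \<open>g \<cdot> f = 0\<close> otherwise.\<close>

definition category_algebra ::
  "('k, 'e) ring_scheme \<Rightarrow> ('o, 'm) category \<Rightarrow> ('k, 'm \<Rightarrow> 'k) module" where
  "category_algebra K D =
     (free_module K (Mor D))
       \<lparr>mult := (\<lambda>a b h. \<Oplus>\<^bsub>K\<^esub>p \<in> {(g, f). g \<in> Mor D \<and> f \<in> Mor D \<and> src D g = tgt D f \<and> cmp D g f = h}.
                  a (fst p) \<otimes>\<^bsub>K\<^esub> b (snd p)),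
        one := (\<Oplus>\<^bsub>free_module K (Mor D)\<^esub>x \<in> Ob D. basis_elt K (idt D x))\<rparr>"


section \<open>Surjective Puig induction\<close>

definition fibre_class :: "('o, 'm) category \<Rightarrow> ('m \<Rightarrow> 'n) \<Rightarrow> 'm \<Rightarrow> 'm set" where
  "fibre_class D sm f = {g \<in> Mor D. sm g = sm f}"

definition Id_class :: "('o, 'm) category \<Rightarrow> ('m \<Rightarrow> 'n) \<Rightarrow> 'o \<Rightarrow> 'm set" where
  "Id_class D sm x = fibre_class D sm (idt D x)"

definition S_monoid ::
  "('k, 'e) ring_scheme \<Rightarrow> ('o, 'm) category \<Rightarrow> ('m \<Rightarrow> 'n) \<Rightarrow> ('m \<Rightarrow> 'k) set" where
  "S_monoid K D sm =
     {\<Oplus>\<^bsub>category_algebra K D\<^esub>x \<in> Ob D. basis_elt K (f x) | f. \<forall>x\<in>Ob D. f x \<in> Id_class D sm x}"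

text \<open>The carrier of the subalgebra \<open>kS\<close>; it is closed under multiplication because \<open>S\<close> is.\<close>

definition S_span ::
  "('k, 'e) ring_scheme \<Rightarrow> ('o, 'm) category \<Rightarrow> ('m \<Rightarrow> 'n) \<Rightarrow> ('m \<Rightarrow> 'k) set" where
  "S_span K D sm = linear_span K (category_algebra K D) (S_monoid K D sm)"

text \<open>The linear extension to \<open>kS\<close> of \<open>\<epsilon> s = 1\<close>. The elements of \<open>S\<close> may be linearly
  dependent, but the sum of the coefficients does not depend on the linear combination: for
  each object \<open>x\<close> it is the sum of the coefficients of the element at the morphisms in
  \<open>Id_class D sm x\<close>. Only for the empty category, where \<open>kD = 0\<close>, is the value at \<open>0\<close>
  arbitrary in \<open>K\<close>; then every interior \<open>kD\<close>-algebra is zero as well.\<close>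

definition augmentation ::
  "('k, 'e) ring_scheme \<Rightarrow> ('o, 'm) category \<Rightarrow> ('m \<Rightarrow> 'n) \<Rightarrow> ('m \<Rightarrow> 'k) \<Rightarrow> 'k" where
  "augmentation K D sm a =
     (SOME r. \<exists>u \<in> S_monoid K D sm \<rightarrow> carrier K.
        a = (\<Oplus>\<^bsub>category_algebra K D\<^esub>s \<in> S_monoid K D sm. u s \<odot>\<^bsub>category_algebra K D\<^esub> s) \<and>
        r = (\<Oplus>\<^bsub>K\<^esub>s \<in> S_monoid K D sm. u s))"

text \<open>The \<open>K\<close>-module \<open>k \<otimes>\<^bsub>kS\<^esub> A\<close> and its elements \<open>a \<otimes> c\<close>.\<close>

definition puig_tensor ::
  "('k, 'e) ring_scheme \<Rightarrow> ('o, 'm) category \<Rightarrow> ('m \<Rightarrow> 'n) \<Rightarrow> ('k, 'a, 'f) module_scheme \<Rightarrow>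
   (('m \<Rightarrow> 'k) \<Rightarrow> 'a) \<Rightarrow> ('k, ('k \<times> 'a \<Rightarrow> 'k) set) module" where
  "puig_tensor K D sm A \<sigma> =
     tensor_module K (S_span K D sm)
       (regular_module K) (\<lambda>a r. a \<otimes>\<^bsub>K\<^esub> augmentation K D sm r)
       A (\<lambda>r c. \<sigma> r \<otimes>\<^bsub>A\<^esub> c)"

definition puig_elt ::
  "('k, 'e) ring_scheme \<Rightarrow> ('o, 'm) category \<Rightarrow> ('m \<Rightarrow> 'n) \<Rightarrow> ('k, 'a, 'f) module_scheme \<Rightarrow>
   (('m \<Rightarrow> 'k) \<Rightarrow> 'a) \<Rightarrow> 'k \<Rightarrow> 'a \<Rightarrow> ('k \<times> 'a \<Rightarrow> 'k) set" where
  "puig_elt K D sm A \<sigma> =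
     tensor_elt K (S_span K D sm)
       (regular_module K) (\<lambda>a r. a \<otimes>\<^bsub>K\<^esub> augmentation K D sm r)
       A (\<lambda>r c. \<sigma> r \<otimes>\<^bsub>A\<^esub> c)"

text \<open>Every element of \<open>k \<otimes>\<^bsub>kS\<^esub> A\<close> is a single tensor, the sum of the \<open>a\<^sub>i \<otimes> c\<^sub>i\<close> being
  \<open>1 \<otimes> c\<close> with \<open>c\<close> the sum of the \<open>a\<^sub>i c\<^sub>i\<close>. Hence the formulas on single tensors determine
  the right action of \<open>S\<close> and the multiplication.\<close>

definition puig_act ::
  "('k, 'e) ring_scheme \<Rightarrow> ('o, 'm) category \<Rightarrow> ('m \<Rightarrow> 'n) \<Rightarrow> ('k, 'a, 'f) module_scheme \<Rightarrow>
   (('m \<Rightarrow> 'k) \<Rightarrow> 'a) \<Rightarrow> ('k \<times> 'a \<Rightarrow> 'k) set \<Rightarrow> ('m \<Rightarrow> 'k) \<Rightarrow> ('k \<times> 'a \<Rightarrow> 'k) set" where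
  "puig_act K D sm A \<sigma> z s =
     (THE w. \<forall>a\<in>carrier K. \<forall>c\<in>carrier A. z = puig_elt K D sm A \<sigma> a c \<longrightarrow>
        w = puig_elt K D sm A \<sigma> a (c \<otimes>\<^bsub>A\<^esub> \<sigma> s))"

definition puig_mult ::
  "('k, 'e) ring_scheme \<Rightarrow> ('o, 'm) category \<Rightarrow> ('m \<Rightarrow> 'n) \<Rightarrow> ('k, 'a, 'f) module_scheme \<Rightarrow>
   (('m \<Rightarrow> 'k) \<Rightarrow> 'a) \<Rightarrow> ('k \<times> 'a \<Rightarrow> 'k) set \<Rightarrow> ('k \<times> 'a \<Rightarrow> 'k) set \<Rightarrow> ('k \<times> 'a \<Rightarrow> 'k) set" where
  "puig_mult K D sm A \<sigma> z1 z2 =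
     (THE w. \<forall>a1\<in>carrier K. \<forall>a2\<in>carrier K. \<forall>c1\<in>carrier A. \<forall>c2\<in>carrier A.
        z1 = puig_elt K D sm A \<sigma> a1 c1 \<longrightarrow> z2 = puig_elt K D sm A \<sigma> a2 c2 \<longrightarrow>
        w = puig_elt K D sm A \<sigma> (a1 \<otimes>\<^bsub>K\<^esub> a2) (c1 \<otimes>\<^bsub>A\<^esub> c2))"

definition IndP ::
  "('k, 'e) ring_scheme \<Rightarrow> ('o, 'm) category \<Rightarrow> ('m \<Rightarrow> 'n) \<Rightarrow> ('k, 'a, 'f) module_scheme \<Rightarrow>
   (('m \<Rightarrow> 'k) \<Rightarrow> 'a) \<Rightarrow> ('k, ('k \<times> 'a \<Rightarrow> 'k) set) module" where
  "IndP K D sm A \<sigma> =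
     (puig_tensor K D sm A \<sigma>)
       \<lparr>carrier := {z \<in> carrier (puig_tensor K D sm A \<sigma>).
                     \<forall>s\<in>S_monoid K D sm. puig_act K D sm A \<sigma> z s = z},
        mult := puig_mult K D sm A \<sigma>,
        one := puig_elt K D sm A \<sigma> \<one>\<^bsub>K\<^esub> \<one>\<^bsub>A\<^esub>\<rparr>"

text \<open>The linear extension of \<open>f' \<mapsto> 1 \<otimes> \<sigma> f\<close>, for any \<open>f\<close> over \<open>f'\<close>.\<close>

definition IndP_interior ::
  "('k, 'e) ring_scheme \<Rightarrow> ('p, 'n) category \<Rightarrow> ('o, 'm) category \<Rightarrow> ('m \<Rightarrow> 'n) \<Rightarrow>
   ('k, 'a, 'f) module_scheme \<Rightarrow> (('m \<Rightarrow> 'k) \<Rightarrow> 'a) \<Rightarrow> ('n \<Rightarrow> 'k) \<Rightarrow> ('k \<times> 'a \<Rightarrow> 'k) set" where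
  "IndP_interior K C D sm A \<sigma> b =
     (\<Oplus>\<^bsub>puig_tensor K D sm A \<sigma>\<^esub>f' \<in> Mor C. b f' \<odot>\<^bsub>puig_tensor K D sm A \<sigma>\<^esub>
        (THE w. \<forall>f\<in>Mor D. sm f = f' \<longrightarrow> w = puig_elt K D sm A \<sigma> \<one>\<^bsub>K\<^esub> (\<sigma> (basis_elt K f))))"

end

theory Submission
  imports Defs
begin

text \<open>Let \<open>J\<close> be the right ideal of \<open>C\<close> generated by the elements \<open>\<sigma> s - 1\<close> with \<open>s\<close> in
  \<open>S\<close>. The map \<open>a \<otimes> c \<mapsto> a c\<close> identifies \<open>k \<otimes>\<^bsub>kS\<^esub> C\<close> with \<open>C / J\<close>, and \<open>IndP\<close> becomes \<open>I / J\<close> with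
  \<open>I = {c. c (\<sigma> s - 1) \<in> J for all s \<in> S}\<close>. This is the idealizer of \<open>J\<close>, that is, the largest
  subalgebra of \<open>C\<close> in which \<open>J\<close> is a two-sided ideal; hence \<open>I / J\<close> is an algebra.

  If \<open>[f] = Id\<^sub>y \<circ> f = f \<circ> Id\<^sub>x\<close>, then completing an element of \<open>Id\<^sub>y\<close> by identities to an element
  of \<open>S\<close> shows that \<open>\<sigma> f\<close> modulo \<open>J\<close> depends on the image of \<open>f\<close> only, and \<open>\<sigma> f\<close> lies in \<open>I\<close>
  because \<open>f \<cdot> s\<close> lies in \<open>[f]\<close> for \<open>s \<in> S\<close>.\<close>

section \<open>Linear maps, submodules and quotients\<close>

text \<open>The obstacle is that \<open>IndP\<close> is given indirectly: its module is a quotient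
  of a free module on pairs, the action and the product are definite descriptions over all ways to
  write a tensor, and the augmentation is a choice. All of this is read off one linear surjection
  \<open>p\<close>, sending c to the tensor of 1 and c. That \<open>p\<close> kills \<open>J\<close>
  is the balancing relation at s in S, where the augmentation is 1. That it kills nothing else needs
  a map from the tensor product back to the quotient by \<open>J\<close>. Such a map is balanced
  over kS because left multiplication by s changes nothing modulo \<open>J\<close>, so that an
  element of kS acts by the coefficient sum of any combination representing it, in particular of the
  one behind the choice. The two factors of a product behave differently. Changing the left factor
  modulo \<open>J\<close> is harmless because \<open>J\<close> is a right ideal; changing the right
  factor requires the left one to lie in \<open>I\<close>. This is why the product is formed on the
  fixed points of S.\<close>

locale linear_map = M: module K M + N: module K N for K (structure) and M and N +
  fixes h
  assumes hom_closed: "x \<in> carrier M \<Longrightarrow> h x \<in> carrier N"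
    and hom_add: "\<lbrakk>x \<in> carrier M; y \<in> carrier M\<rbrakk> \<Longrightarrow> h (x \<oplus>\<^bsub>M\<^esub> y) = h x \<oplus>\<^bsub>N\<^esub> h y"
    and hom_smult: "\<lbrakk>r \<in> carrier K; x \<in> carrier M\<rbrakk> \<Longrightarrow> h (r \<odot>\<^bsub>M\<^esub> x) = r \<odot>\<^bsub>N\<^esub> h x"
begin

lemma hom_zero: "h \<zero>\<^bsub>M\<^esub> = \<zero>\<^bsub>N\<^esub>"
proof -
  have "h \<zero>\<^bsub>M\<^esub> = h (\<zero>\<^bsub>K\<^esub> \<odot>\<^bsub>M\<^esub> \<zero>\<^bsub>M\<^esub>)" by simp
  also have "\<dots> = \<zero>\<^bsub>N\<^esub>" by (subst hom_smult) (simp_all add: hom_closed)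
  finally show ?thesis .
qed

lemma hom_a_inv: "x \<in> carrier M \<Longrightarrow> h (\<ominus>\<^bsub>M\<^esub> x) = \<ominus>\<^bsub>N\<^esub> h x"
  by (metis M.M.a_inv_closed M.M.l_neg N.M.minus_equality hom_add hom_closed hom_zero)

lemma hom_minus:
  "\<lbrakk>x \<in> carrier M; y \<in> carrier M\<rbrakk> \<Longrightarrow> h (x \<ominus>\<^bsub>M\<^esub> y) = h x \<ominus>\<^bsub>N\<^esub> h y"
  by (simp add: a_minus_def hom_add hom_a_inv)

lemma hom_finsum:
  assumes "finite X" "f \<in> X \<rightarrow> carrier M"
  shows "h (\<Oplus>\<^bsub>M\<^esub>x \<in> X. f x) = (\<Oplus>\<^bsub>N\<^esub>x \<in> X. h (f x))"
  using assms
  by (induction X rule: finite_induct) (auto simp: hom_zero hom_add Pi_def hom_closed)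

text \<open>Together with \<open>linear_span_minimal\<close> this replaces induction over a span: a
  linear condition on elements has to be checked on generators only.\<close>

lemma vimage_submodule:
  assumes "submodule J K N"
  shows "submodule {x \<in> carrier M. h x \<in> J} K M"
  using N.submoduleE[OF assms] submodule.smult_closed[OF assms]
    subgroup.one_closed[OF submodule.axioms(1)[OF assms]]
  by (intro M.submoduleI) (auto simp: hom_zero hom_a_inv hom_add hom_smult)

lemma equalizer_submodule:
  assumes "linear_map K M N g"
  shows "submodule {x \<in> carrier M. h x = g x} K M"
proof -
  interpret g: linear_map K M N g by fact
  show ?thesis
    by (intro M.submoduleI)
      (auto simp: hom_zero hom_a_inv hom_add hom_smult g.hom_zero g.hom_a_inv g.hom_add g.hom_smult)
qed

end

lemma (in module) zero_submodule: "submodule {\<zero>\<^bsub>M\<^esub>} R M"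
  by (intro submoduleI) auto

lemma linear_map_comp:
  assumes "linear_map K L M g" "linear_map K M N h"
  shows "linear_map K L N (\<lambda>x. h (g x))"
proof -
  interpret g: linear_map K L M g by fact
  interpret h: linear_map K M N h by fact
  show ?thesis
    by unfold_locales
      (auto simp: g.hom_closed g.hom_add g.hom_smult h.hom_closed h.hom_add h.hom_smult)
qed

section \<open>Spans and finite linear combinations\<close>

context module
begin

lemma submodule_zero: "submodule H R M \<Longrightarrow> \<zero>\<^bsub>M\<^esub> \<in> H"
  using subgroup.one_closed[OF submodule.axioms(1)] by fastforce

lemma submodule_finsum:
  assumes "submodule H R M" "finite X" "\<And>x. x \<in> X \<Longrightarrow> f x \<in> H"
  shows "(\<Oplus>\<^bsub>M\<^esub>x \<in> X. f x) \<in> H"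
  using assms(2,3)
proof (induction X rule: finite_induct)
  case empty
  show ?case using subgroup.one_closed[OF submodule.axioms(1)[OF assms(1)]] by simp
next
  case (insert x X)
  moreover have "f \<in> insert x X \<rightarrow> carrier M"
    using submoduleE(1)[OF assms(1)] insert.prems by auto
  ultimately show ?case
    using submoduleE(5)[OF assms(1)] by (simp add: Pi_def)
qed

text \<open>\<open>Y\<close> inside the carrier puts \<open>carrier M\<close> into the intersected
  family. Otherwise no submodule would contain \<open>Y\<close>, and the empty intersection would be
  the whole type.\<close>

lemma linear_span_submodule:
  assumes "Y \<subseteq> carrier M"
  shows "submodule (linear_span R M Y) R M"
proof -
  have *: "linear_span R M Y \<subseteq> carrier M"
    unfolding linear_span_def using carrier_is_submodule assms by blast
  show ?thesis
    by (intro submoduleI *)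
      (auto simp: linear_span_def submoduleE(3,5) submodule.smult_closed submodule_zero)
qed

lemma linear_span_superset: "Y \<subseteq> linear_span R M Y"
  unfolding linear_span_def by blast

lemma linear_span_minimal: "\<lbrakk>submodule H R M; Y \<subseteq> H\<rbrakk> \<Longrightarrow> linear_span R M Y \<subseteq> H"
  unfolding linear_span_def by blast

text \<open>The combinations indexed by all of \<open>Y\<close> form a submodule \<open>?H\<close>,
  which contains each generator \<open>y\<close> through the coefficients 1 at \<open>y\<close> and
  0 elsewhere. This is the shape of combination that \<open>augmentation\<close> refers to.\<close>

lemma linear_span_finite:
  assumes "finite Y" "Y \<subseteq> carrier M" "a \<in> linear_span R M Y"
  shows "\<exists>u \<in> Y \<rightarrow> carrier R. a = (\<Oplus>\<^bsub>M\<^esub>y \<in> Y. u y \<odot>\<^bsub>M\<^esub> y)"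
proof -
  let ?H = "{a. \<exists>u \<in> Y \<rightarrow> carrier R. a = (\<Oplus>\<^bsub>M\<^esub>y \<in> Y. u y \<odot>\<^bsub>M\<^esub> y)}"
  have cl: "u y \<odot>\<^bsub>M\<^esub> y \<in> carrier M" if "u \<in> Y \<rightarrow> carrier R" "y \<in> Y" for u y
    using that assms(2) by blast
  have "submodule ?H R M"
  proof (intro submoduleI)
    show "?H \<subseteq> carrier M" using cl by (auto intro!: M.finsum_closed)
    have "\<zero>\<^bsub>M\<^esub> = (\<Oplus>\<^bsub>M\<^esub>y \<in> Y. \<zero>\<^bsub>R\<^esub> \<odot>\<^bsub>M\<^esub> y)"
      using assms(2) by (subst M.add.finprod_one_eqI) (auto simp: subset_iff)
    then show "\<zero>\<^bsub>M\<^esub> \<in> ?H" by (intro CollectI bexI[of _ "\<lambda>_. \<zero>\<^bsub>R\<^esub>"]) auto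
  next
    fix a b assume "a \<in> ?H" "b \<in> ?H"
    then obtain u v where u: "u \<in> Y \<rightarrow> carrier R" "a = (\<Oplus>\<^bsub>M\<^esub>y \<in> Y. u y \<odot>\<^bsub>M\<^esub> y)"
      and v: "v \<in> Y \<rightarrow> carrier R" "b = (\<Oplus>\<^bsub>M\<^esub>y \<in> Y. v y \<odot>\<^bsub>M\<^esub> y)" by auto
    have "a \<oplus>\<^bsub>M\<^esub> b = (\<Oplus>\<^bsub>M\<^esub>y \<in> Y. u y \<odot>\<^bsub>M\<^esub> y \<oplus>\<^bsub>M\<^esub> v y \<odot>\<^bsub>M\<^esub> y)"
      unfolding u v using u(1) v(1) cl by (subst M.finsum_addf) auto
    also have "\<dots> = (\<Oplus>\<^bsub>M\<^esub>y \<in> Y. (u y \<oplus>\<^bsub>R\<^esub> v y) \<odot>\<^bsub>M\<^esub> y)"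
      using u(1) v(1) assms(2) by (intro M.finsum_cong') (auto intro!: smult_l_distr[symmetric] smult_closed)
    finally show "a \<oplus>\<^bsub>M\<^esub> b \<in> ?H"
      using u(1) v(1) by (intro CollectI bexI[of _ "\<lambda>y. u y \<oplus>\<^bsub>R\<^esub> v y"]) auto
  next
    fix r a assume r: "r \<in> carrier R" and "a \<in> ?H"
    then obtain u where u: "u \<in> Y \<rightarrow> carrier R" "a = (\<Oplus>\<^bsub>M\<^esub>y \<in> Y. u y \<odot>\<^bsub>M\<^esub> y)" by auto
    have "r \<odot>\<^bsub>M\<^esub> a = (\<Oplus>\<^bsub>M\<^esub>y \<in> Y. r \<odot>\<^bsub>M\<^esub> (u y \<odot>\<^bsub>M\<^esub> y))"
      unfolding u using u(1) assms(1) r cl by (subst finsum_smult_ldistr) auto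
    also have "\<dots> = (\<Oplus>\<^bsub>M\<^esub>y \<in> Y. (r \<otimes>\<^bsub>R\<^esub> u y) \<odot>\<^bsub>M\<^esub> y)"
      using u(1) r assms(2) by (intro M.finsum_cong') (auto intro!: smult_assoc1[symmetric] smult_closed)
    finally show "r \<odot>\<^bsub>M\<^esub> a \<in> ?H"
      using u(1) r by (intro CollectI bexI[of _ "\<lambda>y. r \<otimes>\<^bsub>R\<^esub> u y"]) auto
  next
    fix a assume "a \<in> ?H"
    then obtain u where u: "u \<in> Y \<rightarrow> carrier R" "a = (\<Oplus>\<^bsub>M\<^esub>y \<in> Y. u y \<odot>\<^bsub>M\<^esub> y)" by auto
    have "\<ominus>\<^bsub>M\<^esub> a = (\<ominus>\<^bsub>R\<^esub> \<one>\<^bsub>R\<^esub>) \<odot>\<^bsub>M\<^esub> a"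
      using u cl by (subst smult_l_minus) (auto intro!: M.finsum_closed)
    also have "\<dots> = (\<Oplus>\<^bsub>M\<^esub>y \<in> Y. (\<ominus>\<^bsub>R\<^esub> \<one>\<^bsub>R\<^esub>) \<odot>\<^bsub>M\<^esub> (u y \<odot>\<^bsub>M\<^esub> y))"
      unfolding u using u(1) assms(1) cl by (subst finsum_smult_ldistr) auto
    also have "\<dots> = (\<Oplus>\<^bsub>M\<^esub>y \<in> Y. ((\<ominus>\<^bsub>R\<^esub> \<one>\<^bsub>R\<^esub>) \<otimes>\<^bsub>R\<^esub> u y) \<odot>\<^bsub>M\<^esub> y)"
      using u(1) assms(2) by (intro M.finsum_cong') (auto intro!: smult_assoc1[symmetric] smult_closed)
    finally show "\<ominus>\<^bsub>M\<^esub> a \<in> ?H"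
      using u(1) by (intro CollectI bexI[of _ "\<lambda>y. (\<ominus>\<^bsub>R\<^esub> \<one>\<^bsub>R\<^esub>) \<otimes>\<^bsub>R\<^esub> u y"]) auto
  qed
  moreover have "y \<in> ?H" if y: "y \<in> Y" for y
  proof -
    have "(\<Oplus>\<^bsub>M\<^esub>x \<in> Y. (if y = x then \<one>\<^bsub>R\<^esub> else \<zero>\<^bsub>R\<^esub>) \<odot>\<^bsub>M\<^esub> x)
        = (\<Oplus>\<^bsub>M\<^esub>x \<in> Y. if y = x then x else \<zero>\<^bsub>M\<^esub>)"
      using assms(2) by (intro M.finsum_cong') auto
    also have "\<dots> = y" using M.finsum_singleton[OF y assms(1), of "\<lambda>x. x"] assms(2) by auto
    finally show ?thesis
      by (intro CollectI bexI[of _ "\<lambda>x. if y = x then \<one>\<^bsub>R\<^esub> else \<zero>\<^bsub>R\<^esub>"]) auto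
  qed
  ultimately have "linear_span R M Y \<subseteq> ?H" by (intro linear_span_minimal) auto
  then show ?thesis using assms(3) by blast
qed

end

section \<open>Images of submodules and transport of structure\<close>

lemma (in abelian_group) minus_eqD:
  assumes "x \<ominus> y = \<zero>" "x \<in> carrier G" "y \<in> carrier G"
  shows "x = y"
proof -
  have "\<ominus> (\<ominus> y) = x"
    using assms by (intro minus_equality) (auto simp: a_minus_def)
  then show ?thesis using assms by simp
qed
lemma (in abelian_group) minus_self: "x \<in> carrier G \<Longrightarrow> x \<ominus> x = \<zero>"
  by (simp add: a_minus_def r_neg)

lemma (in abelian_group) minus_zero_right:
  assumes "x \<in> carrier G"
  shows "x \<ominus> \<zero> = x"
proof -
  have "\<ominus> \<zero> = \<zero>" by (intro minus_equality) auto
  then show ?thesis using assms by (simp add: a_minus_def)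
qed

lemma (in linear_map) image_submodule:
  assumes "submodule H K M"
  shows "submodule (h ` H) K N"
proof (intro N.submoduleI)
  note H = M.submoduleE[OF assms] M.submodule_zero[OF assms]
  show "h ` H \<subseteq> carrier N" using H(1) hom_closed by blast
  show "\<zero>\<^bsub>N\<^esub> \<in> h ` H" using H hom_zero by (metis image_eqI)
  show "\<ominus>\<^bsub>N\<^esub> x \<in> h ` H" if x: "x \<in> h ` H" for x
  proof -
    obtain a where "a \<in> H" "x = h a" using x by blast
    moreover from this have "\<ominus>\<^bsub>N\<^esub> x = h (\<ominus>\<^bsub>M\<^esub> a)"
      using H(1) by (simp add: hom_a_inv subset_iff)
    ultimately show ?thesis using H(3) by blast
  qed
  show "x \<oplus>\<^bsub>N\<^esub> y \<in> h ` H" if x: "x \<in> h ` H" and y: "y \<in> h ` H" for x y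
  proof -
    obtain a b where "a \<in> H" "x = h a" "b \<in> H" "y = h b" using x y by blast
    moreover from this have "x \<oplus>\<^bsub>N\<^esub> y = h (a \<oplus>\<^bsub>M\<^esub> b)"
      using H(1) by (simp add: hom_add subset_iff)
    ultimately show ?thesis using H(5) by blast
  qed
  show "r \<odot>\<^bsub>N\<^esub> x \<in> h ` H" if r: "r \<in> carrier K" and x: "x \<in> h ` H" for r x
  proof -
    obtain a where "a \<in> H" "x = h a" using x by blast
    moreover from this have "r \<odot>\<^bsub>N\<^esub> x = h (r \<odot>\<^bsub>M\<^esub> a)"
      using H(1) r by (simp add: hom_smult subset_iff)
    ultimately show ?thesis using H(4) r by blast
  qed
qed

text \<open>Equational laws pass to the image of a map that respects the operations, so nothing
  about \<open>N\<close> has to be known in advance. Quotients by cosets become modules in this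
  way.\<close>

lemma module_image:
  assumes "module K M" and im: "h ` carrier M = carrier N"
    and add: "\<And>x y. \<lbrakk>x \<in> carrier M; y \<in> carrier M\<rbrakk> \<Longrightarrow> h x \<oplus>\<^bsub>N\<^esub> h y = h (x \<oplus>\<^bsub>M\<^esub> y)"
    and smult: "\<And>r x. \<lbrakk>r \<in> carrier K; x \<in> carrier M\<rbrakk> \<Longrightarrow> r \<odot>\<^bsub>N\<^esub> h x = h (r \<odot>\<^bsub>M\<^esub> x)"
    and zero: "\<zero>\<^bsub>N\<^esub> = h \<zero>\<^bsub>M\<^esub>"
  shows "module K N"
proof -
  interpret M: module K M by fact
  show ?thesis
  proof (intro moduleI abelian_groupI; (unfold im[symmetric])?; (elim imageE)?; hypsubst?)
    fix x assume "x \<in> carrier M"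
    then show "\<exists>y\<in>h ` carrier M. y \<oplus>\<^bsub>N\<^esub> h x = \<zero>\<^bsub>N\<^esub>"
      by (intro bexI[of _ "h (\<ominus>\<^bsub>M\<^esub> x)"]) (auto simp: add zero M.M.l_neg)
  qed (auto simp: zero add smult M.M.a_ac M.smult_l_distr M.smult_r_distr M.smult_assoc1 M.R.is_cring)
qed

text \<open>Meant for \<open>h = p\<close> on the subalgebra \<open>I\<close>: the product of
  \<open>IndP\<close> is a definite description, and its laws are all inherited through the
  compatibility \<open>mult\<close>.\<close>

lemma assoc_algebra_image:
  assumes "assoc_algebra K A" and im: "h ` carrier A = carrier B"
    and add: "\<And>x y. \<lbrakk>x \<in> carrier A; y \<in> carrier A\<rbrakk> \<Longrightarrow> h x \<oplus>\<^bsub>B\<^esub> h y = h (x \<oplus>\<^bsub>A\<^esub> y)"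
    and smult: "\<And>r x. \<lbrakk>r \<in> carrier K; x \<in> carrier A\<rbrakk> \<Longrightarrow> r \<odot>\<^bsub>B\<^esub> h x = h (r \<odot>\<^bsub>A\<^esub> x)"
    and zero: "\<zero>\<^bsub>B\<^esub> = h \<zero>\<^bsub>A\<^esub>"
    and mult: "\<And>x y. \<lbrakk>x \<in> carrier A; y \<in> carrier A\<rbrakk> \<Longrightarrow> h x \<otimes>\<^bsub>B\<^esub> h y = h (x \<otimes>\<^bsub>A\<^esub> y)"
    and one: "\<one>\<^bsub>B\<^esub> = h \<one>\<^bsub>A\<^esub>"
  shows "assoc_algebra K B"
proof -
  interpret A: assoc_algebra K A by fact
  have B: "module K B"
    by (rule module_image[OF A.module_axioms im]) (simp_all add: add smult zero)
  have "monoid B"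
    by (rule monoidI; (unfold im[symmetric])?; (elim imageE)?; hypsubst?)
      (auto simp: one mult A.m_assoc)
  moreover have "ring B"
  proof (rule ringI)
    show "abelian_group B" using B by (simp add: module_def)
    show "monoid B" by fact
  qed (unfold im[symmetric], (elim imageE, hypsubst, auto simp: add mult A.l_distr A.r_distr)+)
  moreover have "assoc_algebra_axioms K B"
    by (rule assoc_algebra_axioms.intro; (unfold im[symmetric])?; (elim imageE)?; hypsubst?)
      (auto simp: mult smult A.smult_mult_left A.smult_mult_right)
  ultimately show ?thesis
    using B A.K.field_axioms by (simp add: assoc_algebra_def module_def ring_def)
qed

lemma (in assoc_algebra) subalgebra:
  assumes "submodule H K A" "\<one>\<^bsub>A\<^esub> \<in> H" "\<And>x y. \<lbrakk>x \<in> H; y \<in> H\<rbrakk> \<Longrightarrow> x \<otimes>\<^bsub>A\<^esub> y \<in> H"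
  shows "assoc_algebra K (A\<lparr>carrier := H\<rparr>)"
proof -
  have B: "module K (A\<lparr>carrier := H\<rparr>)"
    by (rule submodule.submodule_is_module[OF assms(1) module_axioms])
  have H: "x \<in> carrier A" if "x \<in> H" for x using submoduleE(1)[OF assms(1)] that by blast
  have "monoid (A\<lparr>carrier := H\<rparr>)"
    by (rule monoidI) (auto simp: assms H A.m_assoc)
  then have "ring (A\<lparr>carrier := H\<rparr>)"
    using B by (intro ringI) (auto simp: module_def H A.l_distr A.r_distr)
  moreover have "assoc_algebra_axioms K (A\<lparr>carrier := H\<rparr>)"
    by (rule assoc_algebra_axioms.intro) (auto simp: H smult_mult_left smult_mult_right)
  ultimately show ?thesis
    using B K.field_axioms by (simp add: assoc_algebra_def module_def ring_def)
qed

section \<open>Quotient modules\<close>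

context module
begin

lemma submodule_abelian_subgroup: "submodule H R M \<Longrightarrow> abelian_subgroup H M"
  by (intro abelian_subgroupI3 additive_subgroup.intro submodule.axioms(1) M.abelian_group_axioms)

lemma quotient_module_coset:
  assumes "submodule H R M"
  shows "carrier (quotient_module M H) = (\<lambda>x. H +>\<^bsub>M\<^esub> x) ` carrier M"
    and "\<zero>\<^bsub>quotient_module M H\<^esub> = H +>\<^bsub>M\<^esub> \<zero>\<^bsub>M\<^esub>"
    and "\<lbrakk>x \<in> carrier M; y \<in> carrier M\<rbrakk>
      \<Longrightarrow> (H +>\<^bsub>M\<^esub> x) \<oplus>\<^bsub>quotient_module M H\<^esub> (H +>\<^bsub>M\<^esub> y) = H +>\<^bsub>M\<^esub> (x \<oplus>\<^bsub>M\<^esub> y)"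
    and "\<lbrakk>r \<in> carrier R; x \<in> carrier M\<rbrakk>
      \<Longrightarrow> r \<odot>\<^bsub>quotient_module M H\<^esub> (H +>\<^bsub>M\<^esub> x) = H +>\<^bsub>M\<^esub> (r \<odot>\<^bsub>M\<^esub> x)"
    and "\<lbrakk>x \<in> carrier M; y \<in> carrier M\<rbrakk> \<Longrightarrow> H +>\<^bsub>M\<^esub> x = H +>\<^bsub>M\<^esub> y \<longleftrightarrow> x \<ominus>\<^bsub>M\<^esub> y \<in> H"
proof -
  interpret H: abelian_subgroup H M by (rule submodule_abelian_subgroup) fact
  note Hc = submoduleE(1)[OF assms]
  show "carrier (quotient_module M H) = (\<lambda>x. H +>\<^bsub>M\<^esub> x) ` carrier M"
    by (auto simp: quotient_module_def A_RCOSETS_def')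
  show "\<zero>\<^bsub>quotient_module M H\<^esub> = H +>\<^bsub>M\<^esub> \<zero>\<^bsub>M\<^esub>"
    using Hc by (simp add: quotient_module_def)
  show "\<lbrakk>x \<in> carrier M; y \<in> carrier M\<rbrakk>
      \<Longrightarrow> (H +>\<^bsub>M\<^esub> x) \<oplus>\<^bsub>quotient_module M H\<^esub> (H +>\<^bsub>M\<^esub> y) = H +>\<^bsub>M\<^esub> (x \<oplus>\<^bsub>M\<^esub> y)" for x y
    by (simp add: quotient_module_def H.a_rcos_sum)
  show eq: "H +>\<^bsub>M\<^esub> x = H +>\<^bsub>M\<^esub> y \<longleftrightarrow> x \<ominus>\<^bsub>M\<^esub> y \<in> H" if "x \<in> carrier M" "y \<in> carrier M" for x y
  proof -
    have "x \<ominus>\<^bsub>M\<^esub> y \<in> H \<longleftrightarrow> x \<in> H +>\<^bsub>M\<^esub> y"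
      using H.a_rcos_module[OF that(2,1)] by (simp add: a_minus_def)
    then show ?thesis
      using H.a_rcos_self[OF that(1)] H.a_repr_independence'[OF _ that(2), of x] by blast
  qed
  assume r: "r \<in> carrier R" and x: "x \<in> carrier M"
  \<comment> \<open>The scalar multiple in \<open>quotient_module\<close> is a union of cosets over
    all representatives \<open>z\<close>. Since r z - r x = r h lies in \<open>H\<close>, these
    cosets coincide and the union is a single coset.\<close>
  have "H +>\<^bsub>M\<^esub> (r \<odot>\<^bsub>M\<^esub> z) = H +>\<^bsub>M\<^esub> (r \<odot>\<^bsub>M\<^esub> x)" if z: "z \<in> H +>\<^bsub>M\<^esub> x" for z
  proof -
    obtain h where h: "h \<in> H" "z = h \<oplus>\<^bsub>M\<^esub> x" using z by (auto simp: a_r_coset_def')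
    have hM: "h \<in> carrier M" using h Hc by auto
    have "r \<odot>\<^bsub>M\<^esub> z \<ominus>\<^bsub>M\<^esub> r \<odot>\<^bsub>M\<^esub> x = r \<odot>\<^bsub>M\<^esub> h"
      using r x hM by (simp add: h(2) smult_r_distr a_minus_def M.a_assoc M.r_neg)
    also have "\<dots> \<in> H" using submodule.smult_closed[OF assms r h(1)] .
    finally show ?thesis using r x hM by (subst eq) (auto simp: h(2))
  qed
  moreover have "x \<in> H +>\<^bsub>M\<^esub> x" using H.a_rcos_self x by blast
  ultimately have "(\<Union>z\<in>H +>\<^bsub>M\<^esub> x. H +>\<^bsub>M\<^esub> (r \<odot>\<^bsub>M\<^esub> z)) = H +>\<^bsub>M\<^esub> (r \<odot>\<^bsub>M\<^esub> x)"
    by blast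
  then show "r \<odot>\<^bsub>quotient_module M H\<^esub> (H +>\<^bsub>M\<^esub> x) = H +>\<^bsub>M\<^esub> (r \<odot>\<^bsub>M\<^esub> x)"
    by (simp add: quotient_module_def)
qed

lemma module_quotient_module:
  assumes "submodule H R M"
  shows "module R (quotient_module M H)"
  by (rule module_image[where h = "\<lambda>x. H +>\<^bsub>M\<^esub> x", OF module_axioms])
    (simp_all add: quotient_module_coset[OF assms])

lemma linear_map_coset:
  assumes "submodule H R M"
  shows "linear_map R M (quotient_module M H) (\<lambda>x. H +>\<^bsub>M\<^esub> x)"
proof -
  interpret Q: module R "quotient_module M H" by (rule module_quotient_module) fact
  show ?thesis by unfold_locales (simp_all add: quotient_module_coset[OF assms])
qed

lemma coset_eq_zero_iff:
  assumes "submodule H R M" "x \<in> carrier M"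
  shows "H +>\<^bsub>M\<^esub> x = \<zero>\<^bsub>quotient_module M H\<^esub> \<longleftrightarrow> x \<in> H"
proof -
  have "H +>\<^bsub>M\<^esub> x = H +>\<^bsub>M\<^esub> \<zero>\<^bsub>M\<^esub> \<longleftrightarrow> x \<ominus>\<^bsub>M\<^esub> \<zero>\<^bsub>M\<^esub> \<in> H"
    by (rule quotient_module_coset(5)[OF assms M.zero_closed])
  then show ?thesis
    unfolding quotient_module_coset(2)[OF assms(1)] M.minus_zero_right[OF assms(2)] .
qed

end

section \<open>Free modules and tensor products\<close>

lemma free_module_simps [simp]:
  "\<zero>\<^bsub>free_module K B\<^esub> = (\<lambda>x. \<zero>\<^bsub>K\<^esub>)"
  "(a \<oplus>\<^bsub>free_module K B\<^esub> b) x = a x \<oplus>\<^bsub>K\<^esub> b x"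
  "(r \<odot>\<^bsub>free_module K B\<^esub> a) x = r \<otimes>\<^bsub>K\<^esub> a x"
  by (simp_all add: free_module_def)

lemma free_module_carrier_iff:
  "a \<in> carrier (free_module K B) \<longleftrightarrow>
     (\<forall>x. a x \<in> carrier K) \<and> {x. a x \<noteq> \<zero>\<^bsub>K\<^esub>} \<subseteq> B \<and> finite {x. a x \<noteq> \<zero>\<^bsub>K\<^esub>}"
  by (simp add: free_module_def)

lemma free_module_carrierD:
  assumes "a \<in> carrier (free_module K B)"
  shows "a x \<in> carrier K" "{x. a x \<noteq> \<zero>\<^bsub>K\<^esub>} \<subseteq> B" "finite {x. a x \<noteq> \<zero>\<^bsub>K\<^esub>}"
    "a x \<noteq> \<zero>\<^bsub>K\<^esub> \<Longrightarrow> x \<in> B"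
  using assms by (auto simp: free_module_carrier_iff)

context cring
begin

lemma module_free_module: "module R (free_module R B)"
proof (intro moduleI abelian_groupI)
  fix a b assume a: "a \<in> carrier (free_module R B)" and b: "b \<in> carrier (free_module R B)"
  have "{x. a x \<oplus> b x \<noteq> \<zero>} \<subseteq> {x. a x \<noteq> \<zero>} \<union> {x. b x \<noteq> \<zero>}" by auto
  moreover have "finite ({x. a x \<noteq> \<zero>} \<union> {x. b x \<noteq> \<zero>})"
    using free_module_carrierD(3) a b by auto
  ultimately show "a \<oplus>\<^bsub>free_module R B\<^esub> b \<in> carrier (free_module R B)"
    using free_module_carrierD(1,2)[OF a] free_module_carrierD(1,2)[OF b]
    unfolding free_module_carrier_iff by (auto intro: finite_subset)
next
  fix r a assume r: "r \<in> carrier R" and a: "a \<in> carrier (free_module R B)"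
  have "{x. r \<otimes> a x \<noteq> \<zero>} \<subseteq> {x. a x \<noteq> \<zero>}" using r by auto
  then show "r \<odot>\<^bsub>free_module R B\<^esub> a \<in> carrier (free_module R B)"
    using r free_module_carrierD[OF a] finite_subset
    unfolding free_module_carrier_iff by (simp add: subset_trans)
next
  fix a assume a: "a \<in> carrier (free_module R B)"
  have "\<ominus> a x \<noteq> \<zero> \<longleftrightarrow> a x \<noteq> \<zero>" for x
    using free_module_carrierD(1)[OF a, of x] by (metis local.minus_minus minus_zero)
  then have "(\<lambda>x. \<ominus> a x) \<in> carrier (free_module R B)"
    using a by (simp add: free_module_carrier_iff)
  then show "\<exists>b\<in>carrier (free_module R B). b \<oplus>\<^bsub>free_module R B\<^esub> a = \<zero>\<^bsub>free_module R B\<^esub>"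
    by (rule bexI[rotated]) (auto simp: fun_eq_iff l_neg free_module_carrierD(1)[OF a])
qed (auto simp: free_module_carrier_iff fun_eq_iff a_ac l_distr r_distr m_assoc is_cring)

lemma basis_elt_closed:
  "x \<in> B \<Longrightarrow> basis_elt R x \<in> carrier (free_module R B)"
proof -
  assume "x \<in> B"
  moreover have "{y. basis_elt R x y \<noteq> \<zero>} \<subseteq> {x}" by (auto simp: basis_elt_def)
  then have "finite {y. basis_elt R x y \<noteq> \<zero>}" by (rule finite_subset) simp
  ultimately show ?thesis by (auto simp: free_module_carrier_iff basis_elt_def)
qed

lemma free_module_finsum_apply:
  assumes "f \<in> I \<rightarrow> carrier (free_module R B)"
  shows "(\<Oplus>\<^bsub>free_module R B\<^esub>i \<in> I. f i) x = (\<Oplus>i \<in> I. f i x)"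
proof (cases "finite I")
  case True
  interpret F: module R "free_module R B" by (rule module_free_module)
  from True assms show ?thesis
  proof (induction I rule: finite_induct)
    case (insert i I)
    moreover have "(\<lambda>i. f i x) \<in> insert i I \<rightarrow> carrier R"
      using insert.prems free_module_carrierD(1) by fastforce
    ultimately show ?case
      by (subst F.M.finsum_insert) (simp_all add: Pi_def)
  qed simp
next
  case False
  interpret F: module R "free_module R B" by (rule module_free_module)
  from False show ?thesis by simp
qed

lemma free_module_expand:
  assumes a: "a \<in> carrier (free_module R B)" and X: "finite X" "X \<subseteq> B" "\<And>x. x \<notin> X \<Longrightarrow> a x = \<zero>"
  shows "a = (\<Oplus>\<^bsub>free_module R B\<^esub>x \<in> X. a x \<odot>\<^bsub>free_module R B\<^esub> basis_elt R x)"
proof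
  fix y
  interpret F: module R "free_module R B" by (rule module_free_module)
  note ax = free_module_carrierD(1)[OF a]
  have "(\<Oplus>\<^bsub>free_module R B\<^esub>x \<in> X. a x \<odot>\<^bsub>free_module R B\<^esub> basis_elt R x) y
      = (\<Oplus>x \<in> X. (a x \<odot>\<^bsub>free_module R B\<^esub> basis_elt R x) y)"
    using X ax by (intro free_module_finsum_apply) (auto intro!: F.smult_closed basis_elt_closed)
  also have "\<dots> = (\<Oplus>x \<in> X. if y = x then a x else \<zero>)"
    using ax by (intro finsum_cong') (auto simp: basis_elt_def)
  also have "\<dots> = a y"
  proof (cases "y \<in> X")
    case True
    then show ?thesis using finsum_singleton[OF True X(1), of a] ax by auto
  next
    case False
    then show ?thesis using X(3) by (subst add.finprod_one_eqI) auto
  qed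
  finally show "a y = (\<Oplus>\<^bsub>free_module R B\<^esub>x \<in> X. a x \<odot>\<^bsub>free_module R B\<^esub> basis_elt R x) y" ..
qed

text \<open>The induction principle of a free module; linear maps out of it are compared on basis
  elements by means of it.\<close>

lemma free_module_subset_submodule:
  assumes "submodule H R (free_module R B)" "\<And>x. x \<in> B \<Longrightarrow> basis_elt R x \<in> H"
  shows "carrier (free_module R B) \<subseteq> H"
proof
  fix a assume a: "a \<in> carrier (free_module R B)"
  interpret F: module R "free_module R B" by (rule module_free_module)
  let ?X = "{x. a x \<noteq> \<zero>}"
  have "a = (\<Oplus>\<^bsub>free_module R B\<^esub>x \<in> ?X. a x \<odot>\<^bsub>free_module R B\<^esub> basis_elt R x)"
    by (rule free_module_expand) (use a free_module_carrierD[OF a] in auto)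
  also have "\<dots> \<in> H"
    using free_module_carrierD[OF a] assms
    by (intro F.submodule_finsum submodule.smult_closed[OF assms(1)]) auto
  finally show "a \<in> H" .
qed

lemma linear_map_free_module_eq:
  assumes "linear_map R (free_module R B) N h" "linear_map R (free_module R B) N g"
    and "\<And>x. x \<in> B \<Longrightarrow> h (basis_elt R x) = g (basis_elt R x)"
    and "a \<in> carrier (free_module R B)"
  shows "h a = g a"
proof -
  have "carrier (free_module R B) \<subseteq> {x \<in> carrier (free_module R B). h x = g x}"
    using assms by (intro free_module_subset_submodule linear_map.equalizer_submodule)
      (auto intro: basis_elt_closed)
  then show ?thesis using assms(4) by blast
qed

end

text \<open>The sum runs over the support, which is finite for every element of a free module even
  if the basis is not; the basis of pairs used for a tensor product may be infinite.\<close>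

definition lin_ext ::
  "('k, 'e) ring_scheme \<Rightarrow> ('k, 'a, 'f) module_scheme \<Rightarrow> ('x \<Rightarrow> 'a) \<Rightarrow> ('x \<Rightarrow> 'k) \<Rightarrow> 'a" where
  "lin_ext K M v a = (\<Oplus>\<^bsub>M\<^esub>x \<in> {x. a x \<noteq> \<zero>\<^bsub>K\<^esub>}. a x \<odot>\<^bsub>M\<^esub> v x)"

context module
begin

text \<open>Elements with different supports can thus be summed over a common index set, as
  additivity of the extension requires.\<close>

lemma lin_ext_superset:
  assumes "a \<in> carrier (free_module R B)" "v \<in> B \<rightarrow> carrier M"
    and "finite X" "{x. a x \<noteq> \<zero>\<^bsub>R\<^esub>} \<subseteq> X" "X \<subseteq> B"
  shows "lin_ext R M v a = (\<Oplus>\<^bsub>M\<^esub>x \<in> X. a x \<odot>\<^bsub>M\<^esub> v x)"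
  unfolding lin_ext_def using free_module_carrierD(1)[OF assms(1)] assms(2-)
  by (intro M.add.finprod_mono_neutral_cong_left) (auto simp: Pi_iff subset_iff)

lemma linear_map_lin_ext:
  assumes v: "v \<in> B \<rightarrow> carrier M"
  shows "linear_map R (free_module R B) M (lin_ext R M v)"
proof -
  interpret F: module R "free_module R B" by (rule module_free_module)
  have cl: "(\<lambda>x. a x \<odot>\<^bsub>M\<^esub> v x) \<in> X \<rightarrow> carrier M"
    if "a \<in> carrier (free_module R B)" "X \<subseteq> B" for a X
    using that v free_module_carrierD(1) by (auto intro!: smult_closed)
  show ?thesis
  proof
    fix a assume a: "a \<in> carrier (free_module R B)"
    show "lin_ext R M v a \<in> carrier M"
      unfolding lin_ext_def by (intro M.finsum_closed cl a) (use free_module_carrierD[OF a] in auto)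
    fix r assume r: "r \<in> carrier R"
    let ?X = "{x. a x \<noteq> \<zero>\<^bsub>R\<^esub>}"
    have X: "finite ?X" "?X \<subseteq> B" using free_module_carrierD[OF a] by auto
    have "lin_ext R M v (r \<odot>\<^bsub>free_module R B\<^esub> a)
        = (\<Oplus>\<^bsub>M\<^esub>x \<in> ?X. (r \<odot>\<^bsub>free_module R B\<^esub> a) x \<odot>\<^bsub>M\<^esub> v x)"
      using r by (intro lin_ext_superset[OF F.smult_closed[OF r a] v X(1) _ X(2)]) auto
    also have "\<dots> = (\<Oplus>\<^bsub>M\<^esub>x \<in> ?X. r \<odot>\<^bsub>M\<^esub> (a x \<odot>\<^bsub>M\<^esub> v x))"
      using r free_module_carrierD[OF a] v by (intro M.finsum_cong') (auto intro!: smult_closed smult_assoc1)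
    also have "\<dots> = r \<odot>\<^bsub>M\<^esub> lin_ext R M v a"
      unfolding lin_ext_def using X r cl[OF a X(2)] by (subst finsum_smult_ldistr) auto
    finally show "lin_ext R M v (r \<odot>\<^bsub>free_module R B\<^esub> a) = r \<odot>\<^bsub>M\<^esub> lin_ext R M v a" .
  next
    fix a b assume a: "a \<in> carrier (free_module R B)" and b: "b \<in> carrier (free_module R B)"
    let ?X = "{x. a x \<noteq> \<zero>\<^bsub>R\<^esub>} \<union> {x. b x \<noteq> \<zero>\<^bsub>R\<^esub>}"
    have X: "finite ?X" "?X \<subseteq> B" using free_module_carrierD[OF a] free_module_carrierD[OF b] by auto
    have "lin_ext R M v (a \<oplus>\<^bsub>free_module R B\<^esub> b)
        = (\<Oplus>\<^bsub>M\<^esub>x \<in> ?X. (a \<oplus>\<^bsub>free_module R B\<^esub> b) x \<odot>\<^bsub>M\<^esub> v x)"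
      by (intro lin_ext_superset[OF F.M.a_closed[OF a b] v X(1) _ X(2)]) auto
    also have "\<dots> = (\<Oplus>\<^bsub>M\<^esub>x \<in> ?X. a x \<odot>\<^bsub>M\<^esub> v x \<oplus>\<^bsub>M\<^esub> b x \<odot>\<^bsub>M\<^esub> v x)"
      using free_module_carrierD(1)[OF a] free_module_carrierD(1)[OF b] v X(2) by (intro M.finsum_cong') (auto intro!: smult_closed smult_l_distr M.a_closed)
    also have "\<dots> = (\<Oplus>\<^bsub>M\<^esub>x \<in> ?X. a x \<odot>\<^bsub>M\<^esub> v x) \<oplus>\<^bsub>M\<^esub> (\<Oplus>\<^bsub>M\<^esub>x \<in> ?X. b x \<odot>\<^bsub>M\<^esub> v x)"
      by (intro M.finsum_addf cl a b X)
    also have "\<dots> = lin_ext R M v a \<oplus>\<^bsub>M\<^esub> lin_ext R M v b"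
      using lin_ext_superset[OF a v X(1) _ X(2)] lin_ext_superset[OF b v X(1) _ X(2)] by simp
    finally show "lin_ext R M v (a \<oplus>\<^bsub>free_module R B\<^esub> b)
        = lin_ext R M v a \<oplus>\<^bsub>M\<^esub> lin_ext R M v b" .
  qed
qed

lemma lin_ext_basis_elt:
  assumes v: "v \<in> B \<rightarrow> carrier M" and x: "x \<in> B"
  shows "lin_ext R M v (basis_elt R x) = v x"
proof -
  have "lin_ext R M v (basis_elt R x) = (\<Oplus>\<^bsub>M\<^esub>y \<in> {x}. basis_elt R x y \<odot>\<^bsub>M\<^esub> v y)"
    using x by (intro lin_ext_superset[OF basis_elt_closed v]) (auto simp: basis_elt_def)
  also have "\<dots> = v x"
    using v x by (subst M.finsum_insert) (auto simp: basis_elt_def Pi_iff)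
  finally show ?thesis .
qed

end

section \<open>The tensor product and its universal property\<close>

locale tensor_product = M: module K M + N: module K N for K (structure) and M and N +
  fixes R :: "'r set" and ra and la
  assumes ra_closed: "\<lbrakk>m \<in> carrier M; r \<in> R\<rbrakk> \<Longrightarrow> ra m r \<in> carrier M"
    and la_closed: "\<lbrakk>r \<in> R; n \<in> carrier N\<rbrakk> \<Longrightarrow> la r n \<in> carrier N"
begin

abbreviation "F \<equiv> free_module K (carrier M \<times> carrier N)"
abbreviation "L \<equiv> linear_span K F (tensor_relations K R M ra N la)"
abbreviation "T \<equiv> tensor_module K R M ra N la"
abbreviation "t \<equiv> tensor_elt K R M ra N la"

sublocale F: module K F
  by (rule M.R.module_free_module)

lemma e_closed: "\<lbrakk>m \<in> carrier M; n \<in> carrier N\<rbrakk> \<Longrightarrow> basis_elt K (m, n) \<in> carrier F"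
  by (rule M.R.basis_elt_closed) simp

lemma tensor_relations_closed: "tensor_relations K R M ra N la \<subseteq> carrier F"
  unfolding tensor_relations_def Let_def
  by (auto intro!: F.M.minus_closed F.M.a_closed F.smult_closed e_closed ra_closed la_closed)

lemma L_submodule: "submodule L K F"
  by (rule F.linear_span_submodule) (rule tensor_relations_closed)

lemma tensor_module_eq: "T = quotient_module F L"
  by (simp add: tensor_module_def Let_def)

lemma tensor_elt_eq: "t m n = L +>\<^bsub>F\<^esub> basis_elt K (m, n)"
  by (simp add: tensor_elt_def Let_def)

sublocale q: linear_map K F T "\<lambda>x. L +>\<^bsub>F\<^esub> x"
  unfolding tensor_module_eq by (rule F.linear_map_coset) (rule L_submodule)

lemma relation_coset_eq:
  assumes "a \<ominus>\<^bsub>F\<^esub> b \<in> tensor_relations K R M ra N la" "a \<in> carrier F" "b \<in> carrier F"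
  shows "L +>\<^bsub>F\<^esub> a = L +>\<^bsub>F\<^esub> b"
  using assms F.quotient_module_coset(5)[OF L_submodule] F.linear_span_superset by blast

lemma tensor_elt_closed: "\<lbrakk>m \<in> carrier M; n \<in> carrier N\<rbrakk> \<Longrightarrow> t m n \<in> carrier T"
  unfolding tensor_elt_eq by (intro q.hom_closed e_closed)

lemma tensor_elt_add_right:
  assumes "m \<in> carrier M" "n \<in> carrier N" "n' \<in> carrier N"
  shows "t m (n \<oplus>\<^bsub>N\<^esub> n') = t m n \<oplus>\<^bsub>T\<^esub> t m n'"
proof -
  have "t m (n \<oplus>\<^bsub>N\<^esub> n') = L +>\<^bsub>F\<^esub> (basis_elt K (m, n) \<oplus>\<^bsub>F\<^esub> basis_elt K (m, n'))"
    unfolding tensor_elt_eq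
  proof (rule relation_coset_eq)
    show "basis_elt K (m, n \<oplus>\<^bsub>N\<^esub> n') \<ominus>\<^bsub>F\<^esub> (basis_elt K (m, n) \<oplus>\<^bsub>F\<^esub> basis_elt K (m, n'))
        \<in> tensor_relations K R M ra N la"
      unfolding tensor_relations_def Let_def using assms by blast
  qed (use assms in \<open>auto intro!: e_closed\<close>)
  then show ?thesis
    using assms by (simp add: tensor_elt_eq q.hom_add e_closed)
qed

lemma tensor_elt_smult_left:
  assumes "a \<in> carrier K" "m \<in> carrier M" "n \<in> carrier N"
  shows "t (a \<odot>\<^bsub>M\<^esub> m) n = a \<odot>\<^bsub>T\<^esub> t m n"
proof -
  have "t (a \<odot>\<^bsub>M\<^esub> m) n = L +>\<^bsub>F\<^esub> (a \<odot>\<^bsub>F\<^esub> basis_elt K (m, n))"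
    unfolding tensor_elt_eq
  proof (rule relation_coset_eq)
    show "basis_elt K (a \<odot>\<^bsub>M\<^esub> m, n) \<ominus>\<^bsub>F\<^esub> (a \<odot>\<^bsub>F\<^esub> basis_elt K (m, n))
        \<in> tensor_relations K R M ra N la"
      unfolding tensor_relations_def Let_def using assms by blast
  qed (use assms in \<open>auto intro!: e_closed\<close>)
  then show ?thesis
    using assms by (simp add: tensor_elt_eq q.hom_smult e_closed)
qed

lemma tensor_elt_smult_right:
  assumes "a \<in> carrier K" "m \<in> carrier M" "n \<in> carrier N"
  shows "t m (a \<odot>\<^bsub>N\<^esub> n) = a \<odot>\<^bsub>T\<^esub> t m n"
proof -
  have "t m (a \<odot>\<^bsub>N\<^esub> n) = L +>\<^bsub>F\<^esub> (a \<odot>\<^bsub>F\<^esub> basis_elt K (m, n))"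
    unfolding tensor_elt_eq
  proof (rule relation_coset_eq)
    show "basis_elt K (m, a \<odot>\<^bsub>N\<^esub> n) \<ominus>\<^bsub>F\<^esub> (a \<odot>\<^bsub>F\<^esub> basis_elt K (m, n))
        \<in> tensor_relations K R M ra N la"
      unfolding tensor_relations_def Let_def using assms by blast
  qed (use assms in \<open>auto intro!: e_closed\<close>)
  then show ?thesis
    using assms by (simp add: tensor_elt_eq q.hom_smult e_closed)
qed

lemma tensor_elt_balanced:
  assumes "m \<in> carrier M" "r \<in> R" "n \<in> carrier N"
  shows "t (ra m r) n = t m (la r n)"
  unfolding tensor_elt_eq
proof (rule relation_coset_eq)
  show "basis_elt K (ra m r, n) \<ominus>\<^bsub>F\<^esub> basis_elt K (m, la r n) \<in> tensor_relations K R M ra N la"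
    unfolding tensor_relations_def Let_def using assms by blast
qed (use assms in \<open>auto intro!: e_closed ra_closed la_closed\<close>)

text \<open>The preimage of \<open>H\<close> in the free module contains all basis elements, hence
  everything, and the cosets exhaust the tensor module.\<close>

lemma tensor_subset_submodule:
  assumes "submodule H K T" "\<And>m n. \<lbrakk>m \<in> carrier M; n \<in> carrier N\<rbrakk> \<Longrightarrow> t m n \<in> H"
  shows "carrier T \<subseteq> H"
proof -
  have "carrier F \<subseteq> {x \<in> carrier F. L +>\<^bsub>F\<^esub> x \<in> H}"
    using assms by (intro M.R.free_module_subset_submodule q.vimage_submodule)
      (auto intro: e_closed simp: tensor_elt_eq)
  then show ?thesis
    unfolding tensor_module_eq F.quotient_module_coset(1)[OF L_submodule] by blast
qed

text \<open>The universal property. The linear extension \<open>\<phi>\<close> of \<open>v\<close>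
  to the free module kills each of the five families of relations by one of the assumptions on
  \<open>v\<close>; so it kills their span and factors through the cosets.\<close>

lemma tensor_lift:
  assumes "module K P"
    and v: "\<And>m n. \<lbrakk>m \<in> carrier M; n \<in> carrier N\<rbrakk> \<Longrightarrow> v m n \<in> carrier P"
      "\<And>m m' n. \<lbrakk>m \<in> carrier M; m' \<in> carrier M; n \<in> carrier N\<rbrakk>
        \<Longrightarrow> v (m \<oplus>\<^bsub>M\<^esub> m') n = v m n \<oplus>\<^bsub>P\<^esub> v m' n"
      "\<And>m n n'. \<lbrakk>m \<in> carrier M; n \<in> carrier N; n' \<in> carrier N\<rbrakk>
        \<Longrightarrow> v m (n \<oplus>\<^bsub>N\<^esub> n') = v m n \<oplus>\<^bsub>P\<^esub> v m n'"
      "\<And>a m n. \<lbrakk>a \<in> carrier K; m \<in> carrier M; n \<in> carrier N\<rbrakk>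
        \<Longrightarrow> v (a \<odot>\<^bsub>M\<^esub> m) n = a \<odot>\<^bsub>P\<^esub> v m n"
      "\<And>a m n. \<lbrakk>a \<in> carrier K; m \<in> carrier M; n \<in> carrier N\<rbrakk>
        \<Longrightarrow> v m (a \<odot>\<^bsub>N\<^esub> n) = a \<odot>\<^bsub>P\<^esub> v m n"
      "\<And>m r n. \<lbrakk>m \<in> carrier M; r \<in> R; n \<in> carrier N\<rbrakk> \<Longrightarrow> v (ra m r) n = v m (la r n)"
  obtains h where "linear_map K T P h"
    "\<And>m n. \<lbrakk>m \<in> carrier M; n \<in> carrier N\<rbrakk> \<Longrightarrow> h (t m n) = v m n"
proof -
  interpret P: module K P by fact
  let ?v = "\<lambda>(m, n). v m n"
  have vP: "?v \<in> carrier M \<times> carrier N \<rightarrow> carrier P" using v(1) by auto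
  define \<phi> where "\<phi> = lin_ext K P ?v"
  interpret \<phi>: linear_map K F P \<phi>
    unfolding \<phi>_def by (rule P.linear_map_lin_ext[OF vP])
  have \<phi>e: "\<phi> (basis_elt K (m, n)) = v m n" if "m \<in> carrier M" "n \<in> carrier N" for m n
    unfolding \<phi>_def using P.lin_ext_basis_elt[OF vP, of "(m, n)"] that by simp
  have "L \<subseteq> {x \<in> carrier F. \<phi> x \<in> {\<zero>\<^bsub>P\<^esub>}}"
  proof (intro F.linear_span_minimal \<phi>.vimage_submodule P.zero_submodule subsetI CollectI conjI)
    fix x assume x: "x \<in> tensor_relations K R M ra N la"
    then show "x \<in> carrier F" using tensor_relations_closed by blast
    have "\<phi> x = \<zero>\<^bsub>P\<^esub>"
      using x unfolding tensor_relations_def Let_def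
      by (elim UnE CollectE exE conjE)
        (simp_all add: \<phi>.hom_minus \<phi>.hom_add \<phi>.hom_smult \<phi>e v e_closed ra_closed la_closed,
          simp_all add: v la_closed a_minus_def P.M.r_neg)
    then show "\<phi> x \<in> {\<zero>\<^bsub>P\<^esub>}" by simp
  qed
  then have ker: "\<phi> a = \<phi> b" if "a \<in> carrier F" "b \<in> carrier F" "L +>\<^bsub>F\<^esub> a = L +>\<^bsub>F\<^esub> b" for a b
  proof -
    have "a \<ominus>\<^bsub>F\<^esub> b \<in> L"
      using that F.quotient_module_coset(5)[OF L_submodule] by blast
    then have "\<phi> (a \<ominus>\<^bsub>F\<^esub> b) = \<zero>\<^bsub>P\<^esub>"
      using \<open>L \<subseteq> _\<close> by blast
    then have "\<phi> a \<ominus>\<^bsub>P\<^esub> \<phi> b = \<zero>\<^bsub>P\<^esub>"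
      using \<phi>.hom_minus[OF that(1,2)] by simp
    then show ?thesis by (rule P.M.minus_eqD) (intro \<phi>.hom_closed that)+
  qed
  \<comment> \<open>A representative of the coset is chosen; by \<open>ker\<close> the value does
    not depend on it.\<close>
  define h where "h Z = \<phi> (SOME a. a \<in> carrier F \<and> Z = L +>\<^bsub>F\<^esub> a)" for Z
  have h: "h (L +>\<^bsub>F\<^esub> a) = \<phi> a" if "a \<in> carrier F" for a
    unfolding h_def by (rule someI2[of _ a]) (use that ker in blast)+
  show ?thesis
  proof
    show "linear_map K T P h"
    proof unfold_locales
      fix x assume "x \<in> carrier T"
      then obtain a where a: "a \<in> carrier F" "x = L +>\<^bsub>F\<^esub> a"
        unfolding tensor_module_eq F.quotient_module_coset(1)[OF L_submodule] by blast
      show "h x \<in> carrier P" using a by (simp add: h \<phi>.hom_closed)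
      show "h (r \<odot>\<^bsub>T\<^esub> x) = r \<odot>\<^bsub>P\<^esub> h x" if "r \<in> carrier K" for r
        using that a by (simp add: h \<phi>.hom_smult flip: q.hom_smult)
      fix y assume "y \<in> carrier T"
      then obtain b where b: "b \<in> carrier F" "y = L +>\<^bsub>F\<^esub> b"
        unfolding tensor_module_eq F.quotient_module_coset(1)[OF L_submodule] by blast
      show "h (x \<oplus>\<^bsub>T\<^esub> y) = h x \<oplus>\<^bsub>P\<^esub> h y"
        using a b by (simp add: h \<phi>.hom_add flip: q.hom_add)
    qed
    show "h (t m n) = v m n" if "m \<in> carrier M" "n \<in> carrier N" for m n
      using that by (simp add: tensor_elt_eq h e_closed \<phi>e)
  qed
qed

end

section \<open>Category algebras\<close>

lemma (in module) module_regular_module: "module R (regular_module R)"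
proof (intro moduleI abelian_groupI)
  fix x assume "x \<in> carrier (regular_module R)"
  then show "\<exists>y\<in>carrier (regular_module R). y \<oplus>\<^bsub>regular_module R\<^esub> x = \<zero>\<^bsub>regular_module R\<^esub>"
    by (intro bexI[of _ "\<ominus>\<^bsub>R\<^esub> x"]) (auto simp: regular_module_def R.l_neg)
qed (auto simp: regular_module_def R.a_ac R.l_distr R.r_distr R.m_assoc R.is_cring)

text \<open>\<open>finsum\<close> reads only carrier, zero and addition, which the two records
  share.\<close>

lemma finsum_regular_module [simp]: "finsum (regular_module K) = finsum K"
  by (simp add: fun_eq_iff finsum_def finprod_def regular_module_def)

lemma (in module) linear_map_smult:
  assumes "x \<in> carrier M"
  shows "linear_map R (regular_module R) M (\<lambda>r. r \<odot>\<^bsub>M\<^esub> x)"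
proof -
  interpret K: module R "regular_module R" by (rule module_regular_module)
  show ?thesis
    by unfold_locales (use assms in \<open>auto simp: regular_module_def smult_l_distr smult_assoc1\<close>)
qed

lemma (in assoc_algebra) linear_map_mult_right:
  "x \<in> carrier A \<Longrightarrow> linear_map K A A (\<lambda>y. y \<otimes>\<^bsub>A\<^esub> x)"
  by unfold_locales (auto simp: A.l_distr smult_mult_left)

lemma (in assoc_algebra) linear_map_mult_left:
  "x \<in> carrier A \<Longrightarrow> linear_map K A A (\<lambda>y. x \<otimes>\<^bsub>A\<^esub> y)"
  by unfold_locales (auto simp: A.r_distr smult_mult_right)

lemma (in assoc_algebra) smult_mult_smult:
  assumes "a \<in> carrier K" "b \<in> carrier K" "x \<in> carrier A" "y \<in> carrier A"
  shows "(a \<odot>\<^bsub>A\<^esub> x) \<otimes>\<^bsub>A\<^esub> (b \<odot>\<^bsub>A\<^esub> y) = (a \<otimes>\<^bsub>K\<^esub> b) \<odot>\<^bsub>A\<^esub> (x \<otimes>\<^bsub>A\<^esub> y)"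
proof -
  have "(a \<odot>\<^bsub>A\<^esub> x) \<otimes>\<^bsub>A\<^esub> (b \<odot>\<^bsub>A\<^esub> y) = a \<odot>\<^bsub>A\<^esub> (x \<otimes>\<^bsub>A\<^esub> (b \<odot>\<^bsub>A\<^esub> y))"
    using assms by (intro smult_mult_left) auto
  also have "\<dots> = a \<odot>\<^bsub>A\<^esub> (b \<odot>\<^bsub>A\<^esub> (x \<otimes>\<^bsub>A\<^esub> y))"
    using assms by (simp only: smult_mult_right)
  also have "\<dots> = (a \<otimes>\<^bsub>K\<^esub> b) \<odot>\<^bsub>A\<^esub> (x \<otimes>\<^bsub>A\<^esub> y)"
    using assms by (intro smult_assoc1[symmetric]) auto
  finally show ?thesis .
qed

text \<open>The category algebra differs from the free module in \<open>mult\<close> and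
  \<open>one\<close> only. With these equations linear arguments take place in the free module, and
  the algebra record is left for products and the identity.\<close>

lemma category_algebra_simps [simp]:
  "carrier (category_algebra K D) = carrier (free_module K (Mor D))"
  "\<zero>\<^bsub>category_algebra K D\<^esub> = \<zero>\<^bsub>free_module K (Mor D)\<^esub>"
  "add (category_algebra K D) = add (free_module K (Mor D))"
  "smult (category_algebra K D) = smult (free_module K (Mor D))"
  "finsum (category_algebra K D) = finsum (free_module K (Mor D))"
  "linear_span K (category_algebra K D) = linear_span K (free_module K (Mor D))"
proof -
  show *: "carrier (category_algebra K D) = carrier (free_module K (Mor D))"
    "\<zero>\<^bsub>category_algebra K D\<^esub> = \<zero>\<^bsub>free_module K (Mor D)\<^esub>"
    "add (category_algebra K D) = add (free_module K (Mor D))"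
    "smult (category_algebra K D) = smult (free_module K (Mor D))"
    by (simp_all add: category_algebra_def)
  show "finsum (category_algebra K D) = finsum (free_module K (Mor D))"
    by (simp add: fun_eq_iff finsum_def *)
  show "linear_span K (category_algebra K D) = linear_span K (free_module K (Mor D))"
    by (simp add: fun_eq_iff linear_span_def submodule_def submodule_axioms_def *)
qed

lemma category_algebra_one:
  "\<one>\<^bsub>category_algebra K D\<^esub> = (\<Oplus>\<^bsub>free_module K (Mor D)\<^esub>x \<in> Ob D. basis_elt K (idt D x))"
  by (simp add: category_algebra_def)

locale category_over = cring K for K (structure) +
  fixes D :: "('o, 'm) category"
  assumes finite_category: "finite_category D"
begin

abbreviation "alg \<equiv> category_algebra K D"
abbreviation "F \<equiv> free_module K (Mor D)"
abbreviation "e \<equiv> basis_elt K"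

sublocale F: module K F
  by (rule module_free_module)

lemma category_axioms:
  "f \<in> Mor D \<Longrightarrow> src D f \<in> Ob D" "f \<in> Mor D \<Longrightarrow> tgt D f \<in> Ob D"
  "x \<in> Ob D \<Longrightarrow> idt D x \<in> Mor D" "x \<in> Ob D \<Longrightarrow> src D (idt D x) = x"
  "x \<in> Ob D \<Longrightarrow> tgt D (idt D x) = x"
  "\<lbrakk>f \<in> Mor D; g \<in> Mor D; src D g = tgt D f\<rbrakk> \<Longrightarrow> cmp D g f \<in> Mor D"
  "\<lbrakk>f \<in> Mor D; g \<in> Mor D; src D g = tgt D f\<rbrakk> \<Longrightarrow> src D (cmp D g f) = src D f"
  "\<lbrakk>f \<in> Mor D; g \<in> Mor D; src D g = tgt D f\<rbrakk> \<Longrightarrow> tgt D (cmp D g f) = tgt D g"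
  "f \<in> Mor D \<Longrightarrow> cmp D f (idt D (src D f)) = f"
  "f \<in> Mor D \<Longrightarrow> cmp D (idt D (tgt D f)) f = f"
  using finite_category unfolding finite_category_def is_category_def by blast+

lemma finite_Mor: "finite (Mor D)"
  using finite_category by (simp add: finite_category_def)

text \<open>\<open>src\<close> inverts \<open>idt\<close>; hence finitely many morphisms leave only
  finitely many objects.\<close>

lemma inj_idt: "inj_on (idt D) (Ob D)"
  by (rule inj_on_inverseI[where g = "src D"]) (rule category_axioms)

lemma finite_Ob: "finite (Ob D)"
proof (rule finite_imageD[OF _ inj_idt])
  show "finite (idt D ` Ob D)"
    by (rule finite_subset[OF _ finite_Mor]) (use category_axioms(3) in blast)
qed

lemma e_closed: "f \<in> Mor D \<Longrightarrow> e f \<in> carrier F"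
  by (rule basis_elt_closed)

abbreviation factorizations :: "'m \<Rightarrow> ('m \<times> 'm) set" where
  "factorizations h \<equiv> {(g, f). g \<in> Mor D \<and> f \<in> Mor D \<and> src D g = tgt D f \<and> cmp D g f = h}"

lemma mult_apply:
  "(a \<otimes>\<^bsub>alg\<^esub> b) h = (\<Oplus>p \<in> factorizations h. a (fst p) \<otimes> b (snd p))"
  by (simp add: category_algebra_def)

lemma finite_factorizations: "finite (factorizations h)"
  by (rule finite_subset[of _ "Mor D \<times> Mor D"]) (auto simp: finite_Mor)

lemma mult_closed:
  assumes "a \<in> carrier F" "b \<in> carrier F"
  shows "a \<otimes>\<^bsub>alg\<^esub> b \<in> carrier F"
proof -
  note ab = free_module_carrierD(1)[OF assms(1)] free_module_carrierD(1)[OF assms(2)]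
  have "(a \<otimes>\<^bsub>alg\<^esub> b) h = \<zero>" if "h \<notin> Mor D" for h
  proof -
    have "factorizations h = {}" using that category_axioms(6) by blast
    then show ?thesis unfolding mult_apply by (simp only: finsum_empty)
  qed
  then have *: "{h. (a \<otimes>\<^bsub>alg\<^esub> b) h \<noteq> \<zero>} \<subseteq> Mor D" by blast
  moreover have "(a \<otimes>\<^bsub>alg\<^esub> b) h \<in> carrier K" for h
    unfolding mult_apply by (rule finsum_closed) (auto simp: ab)
  ultimately show ?thesis
    unfolding free_module_carrier_iff using finite_subset[OF * finite_Mor] by blast
qed

lemma linear_map_alg_mult_right:
  assumes b: "b \<in> carrier F"
  shows "linear_map K F F (\<lambda>a. a \<otimes>\<^bsub>alg\<^esub> b)"
proof unfold_locales
  note bc = free_module_carrierD(1)[OF b]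
  fix a assume a: "a \<in> carrier F"
  note ac = free_module_carrierD(1)[OF a]
  show "a \<otimes>\<^bsub>alg\<^esub> b \<in> carrier F" by (rule mult_closed) fact+
  show "(r \<odot>\<^bsub>F\<^esub> a) \<otimes>\<^bsub>alg\<^esub> b = r \<odot>\<^bsub>F\<^esub> (a \<otimes>\<^bsub>alg\<^esub> b)" if r: "r \<in> carrier K" for r
  proof
    fix h
    show "((r \<odot>\<^bsub>F\<^esub> a) \<otimes>\<^bsub>alg\<^esub> b) h = (r \<odot>\<^bsub>F\<^esub> (a \<otimes>\<^bsub>alg\<^esub> b)) h"
      unfolding mult_apply free_module_simps
      using finsum_rdistr[OF finite_factorizations r, of "\<lambda>p. a (fst p) \<otimes> b (snd p)" h]
      by (simp add: ac bc r m_assoc)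
  qed
  fix a' assume a': "a' \<in> carrier F"
  note ac' = free_module_carrierD(1)[OF a']
  show "(a \<oplus>\<^bsub>F\<^esub> a') \<otimes>\<^bsub>alg\<^esub> b = (a \<otimes>\<^bsub>alg\<^esub> b) \<oplus>\<^bsub>F\<^esub> (a' \<otimes>\<^bsub>alg\<^esub> b)"
  proof
    fix h
    have "((a \<oplus>\<^bsub>F\<^esub> a') \<otimes>\<^bsub>alg\<^esub> b) h
        = (\<Oplus>p \<in> factorizations h. a (fst p) \<otimes> b (snd p) \<oplus> a' (fst p) \<otimes> b (snd p))"
      unfolding mult_apply by (rule finsum_cong') (auto simp: ac ac' bc l_distr)
    also have "\<dots> = ((a \<otimes>\<^bsub>alg\<^esub> b) \<oplus>\<^bsub>F\<^esub> (a' \<otimes>\<^bsub>alg\<^esub> b)) h"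
      unfolding free_module_simps mult_apply by (rule finsum_addf) (auto simp: ac ac' bc)
    finally show "((a \<oplus>\<^bsub>F\<^esub> a') \<otimes>\<^bsub>alg\<^esub> b) h = ((a \<otimes>\<^bsub>alg\<^esub> b) \<oplus>\<^bsub>F\<^esub> (a' \<otimes>\<^bsub>alg\<^esub> b)) h" .
  qed
qed

lemma linear_map_alg_mult_left:
  assumes a: "a \<in> carrier F"
  shows "linear_map K F F (\<lambda>b. a \<otimes>\<^bsub>alg\<^esub> b)"
proof unfold_locales
  note ac = free_module_carrierD(1)[OF a]
  fix b assume b: "b \<in> carrier F"
  note bc = free_module_carrierD(1)[OF b]
  show "a \<otimes>\<^bsub>alg\<^esub> b \<in> carrier F" by (rule mult_closed) fact+
  show "a \<otimes>\<^bsub>alg\<^esub> (r \<odot>\<^bsub>F\<^esub> b) = r \<odot>\<^bsub>F\<^esub> (a \<otimes>\<^bsub>alg\<^esub> b)" if r: "r \<in> carrier K" for r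
  proof
    fix h
    show "(a \<otimes>\<^bsub>alg\<^esub> (r \<odot>\<^bsub>F\<^esub> b)) h = (r \<odot>\<^bsub>F\<^esub> (a \<otimes>\<^bsub>alg\<^esub> b)) h"
      unfolding mult_apply free_module_simps
      using finsum_rdistr[OF finite_factorizations r, of "\<lambda>p. a (fst p) \<otimes> b (snd p)" h]
      by (simp add: ac bc r m_lcomm)
  qed
  fix b' assume b': "b' \<in> carrier F"
  note bc' = free_module_carrierD(1)[OF b']
  show "a \<otimes>\<^bsub>alg\<^esub> (b \<oplus>\<^bsub>F\<^esub> b') = (a \<otimes>\<^bsub>alg\<^esub> b) \<oplus>\<^bsub>F\<^esub> (a \<otimes>\<^bsub>alg\<^esub> b')"
  proof
    fix h
    have "(a \<otimes>\<^bsub>alg\<^esub> (b \<oplus>\<^bsub>F\<^esub> b')) h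
        = (\<Oplus>p \<in> factorizations h. a (fst p) \<otimes> b (snd p) \<oplus> a (fst p) \<otimes> b' (snd p))"
      unfolding mult_apply by (rule finsum_cong') (auto simp: ac bc bc' r_distr)
    also have "\<dots> = ((a \<otimes>\<^bsub>alg\<^esub> b) \<oplus>\<^bsub>F\<^esub> (a \<otimes>\<^bsub>alg\<^esub> b')) h"
      unfolding free_module_simps mult_apply by (rule finsum_addf) (auto simp: ac bc bc')
    finally show "(a \<otimes>\<^bsub>alg\<^esub> (b \<oplus>\<^bsub>F\<^esub> b')) h = ((a \<otimes>\<^bsub>alg\<^esub> b) \<oplus>\<^bsub>F\<^esub> (a \<otimes>\<^bsub>alg\<^esub> b')) h" .
  qed
qed

text \<open>In the sum defining the product at \<open>h\<close>, only the pair \<open>(g, f)\<close>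
  can contribute, and it is among the factorizations of \<open>h\<close> exactly if it is composable
  with composite \<open>h\<close>.\<close>

lemma basis_mult:
  assumes g: "g \<in> Mor D" and f: "f \<in> Mor D"
  shows "e g \<otimes>\<^bsub>alg\<^esub> e f = (if src D g = tgt D f then e (cmp D g f) else \<zero>\<^bsub>F\<^esub>)"
proof
  fix h
  have "(e g \<otimes>\<^bsub>alg\<^esub> e f) h = (\<Oplus>p \<in> factorizations h. if (g, f) = p then \<one> else \<zero>)"
    unfolding mult_apply by (rule finsum_cong') (auto simp: basis_elt_def)
  also have "\<dots> = (if (g, f) \<in> factorizations h then \<one> else \<zero>)"
  proof (cases "(g, f) \<in> factorizations h")
    case True
    then show ?thesis
      using finsum_singleton[OF True finite_factorizations, of "\<lambda>_. \<one>"] by simp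
  next
    case False
    have "(\<Oplus>p \<in> factorizations h. if (g, f) = p then \<one> else \<zero>) = \<zero>"
      by (rule add.finprod_one_eqI) (use False in \<open>simp only: if_not_P split: if_splits, blast\<close>)
    with False show ?thesis by (simp only: if_False)
  qed
  also have "\<dots> = (if src D g = tgt D f then e (cmp D g f) else \<zero>\<^bsub>F\<^esub>) h"
    using g f by (auto simp: basis_elt_def)
  finally show "(e g \<otimes>\<^bsub>alg\<^esub> e f) h = (if src D g = tgt D f then e (cmp D g f) else \<zero>\<^bsub>F\<^esub>) h" .
qed

text \<open>Both sides are bilinear. The identity is extended from basis elements in two stages: in
  \<open>a\<close> with a basis element on the right, then in \<open>b\<close> with \<open>a\<close>
  arbitrary.\<close>

lemma linear_map_multiplicativeI:
  assumes B: "assoc_algebra K B" and \<psi>: "linear_map K F B \<psi>"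
    and basis: "\<And>g f. \<lbrakk>g \<in> Mor D; f \<in> Mor D\<rbrakk> \<Longrightarrow> \<psi> (e g \<otimes>\<^bsub>alg\<^esub> e f) = \<psi> (e g) \<otimes>\<^bsub>B\<^esub> \<psi> (e f)"
    and a: "a \<in> carrier F" and b: "b \<in> carrier F"
  shows "\<psi> (a \<otimes>\<^bsub>alg\<^esub> b) = \<psi> a \<otimes>\<^bsub>B\<^esub> \<psi> b"
proof -
  interpret B: assoc_algebra K B by fact
  interpret \<psi>: linear_map K F B \<psi> by fact
  have 1: "\<psi> (a \<otimes>\<^bsub>alg\<^esub> e f) = \<psi> a \<otimes>\<^bsub>B\<^esub> \<psi> (e f)" if f: "f \<in> Mor D" for f
    by (rule linear_map_free_module_eq[OF _ _ _ a],
        rule linear_map_comp[OF linear_map_alg_mult_right[OF e_closed[OF f]] \<psi>],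
        rule linear_map_comp[OF \<psi> B.linear_map_mult_right[OF \<psi>.hom_closed[OF e_closed[OF f]]]],
        rule basis[OF _ f])
  show ?thesis
    by (rule linear_map_free_module_eq[OF _ _ _ b],
        rule linear_map_comp[OF linear_map_alg_mult_left[OF a] \<psi>],
        rule linear_map_comp[OF \<psi> B.linear_map_mult_left[OF \<psi>.hom_closed[OF a]]],
        rule 1)
qed

end

section \<open>Surjective Puig induction\<close>

text \<open>The interior algebra, called \<open>C\<close> in the overview and in the theorem, is
  \<open>A\<close> here; \<open>C\<close> names the target category.\<close>

locale puig_setup =
  fixes K :: "('k, 'e) ring_scheme" (structure)
    and C :: "('p, 'n) category"
    and D :: "('o, 'm) category"
    and so :: "'o \<Rightarrow> 'p" and sm :: "'m \<Rightarrow> 'n"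
    and A :: "('k, 'a, 'f) module_scheme"
    and \<sigma> :: "('m \<Rightarrow> 'k) \<Rightarrow> 'a"
  assumes field: "field K"
    and finite_C: "finite_category C"
    and finite_D: "finite_category D"
    and is_functor: "is_functor D C so sm"
    and inj_so: "inj_on so (Ob D)"
    and surj_sm: "sm ` Mor D = Mor C"
    and interior: "interior_algebra K (category_algebra K D) A \<sigma>"
begin

sublocale A: assoc_algebra K A
  using interior by (simp add: interior_algebra_def)

sublocale D: category_over K D
  by (intro category_over.intro category_over_axioms.intro finite_D A.K.is_cring)

sublocale C: category_over K C
  by (intro category_over.intro category_over_axioms.intro finite_C A.K.is_cring)

section \<open>Objects, and the fibres over identities\<close>

lemma functor_simps:
  "x \<in> Ob D \<Longrightarrow> so x \<in> Ob C" "x \<in> Ob D \<Longrightarrow> sm (idt D x) = idt C (so x)"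
  "f \<in> Mor D \<Longrightarrow> sm f \<in> Mor C" "f \<in> Mor D \<Longrightarrow> src C (sm f) = so (src D f)"
  "f \<in> Mor D \<Longrightarrow> tgt C (sm f) = so (tgt D f)"
  "\<lbrakk>f \<in> Mor D; g \<in> Mor D; src D g = tgt D f\<rbrakk> \<Longrightarrow> sm (cmp D g f) = cmp C (sm g) (sm f)"
  using is_functor unfolding is_functor_def by blast+

text \<open>Surjectivity on morphisms suffices: a morphism over the identity of \<open>x\<close> has
  its source over \<open>x\<close>.\<close>

lemma so_image_Ob: "so ` Ob D = Ob C"
proof (intro equalityI subsetI)
  fix x assume x: "x \<in> Ob C"
  then obtain f where f: "f \<in> Mor D" "sm f = idt C x"
    using C.category_axioms(3) surj_sm by (metis imageE)
  then have "so (src D f) = x"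
    using functor_simps(4)[OF f(1)] C.category_axioms(4)[OF x] by simp
  then show "x \<in> so ` Ob D" using D.category_axioms(1)[OF f(1)] by blast
qed (auto simp: functor_simps)

text \<open>Source and target of a morphism over an identity have the same image as
  \<open>x\<close>; injectivity of \<open>so\<close> makes it an endomorphism of
  \<open>x\<close>.\<close>

lemma Id_class:
  assumes "x \<in> Ob D" "g \<in> Id_class D sm x"
  shows "g \<in> Mor D" "sm g = idt C (so x)" "src D g = x" "tgt D g = x"
proof -
  show g: "g \<in> Mor D" and sg: "sm g = idt C (so x)"
    using assms by (auto simp: Id_class_def fibre_class_def functor_simps)
  have "so (src D g) = so x" "so (tgt D g) = so x"
    using functor_simps(4,5)[OF g] functor_simps(1)[OF assms(1)]
    by (simp_all add: sg C.category_axioms)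
  then show "src D g = x" "tgt D g = x"
    using inj_so g assms(1) D.category_axioms(1,2) by (auto dest: inj_onD)
qed

lemma idt_Id_class: "x \<in> Ob D \<Longrightarrow> idt D x \<in> Id_class D sm x"
  by (simp add: Id_class_def fibre_class_def D.category_axioms)

section \<open>The monoid S and its products with basis elements\<close>

definition Id_sum :: "('o \<Rightarrow> 'm) \<Rightarrow> 'm \<Rightarrow> 'k" where
  "Id_sum \<phi> = (\<Oplus>\<^bsub>D.F\<^esub>x \<in> Ob D. D.e (\<phi> x))"

abbreviation S where "S \<equiv> S_monoid K D sm"
abbreviation "Id_choice \<equiv> {\<phi>. \<forall>x \<in> Ob D. \<phi> x \<in> Id_class D sm x}"

lemma Id_choice_closed: "\<lbrakk>\<phi> \<in> Id_choice; x \<in> Ob D\<rbrakk> \<Longrightarrow> D.e (\<phi> x) \<in> carrier D.F"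
  by (auto intro: D.e_closed Id_class)

lemma S_eq: "S = Id_sum ` Id_choice"
  by (auto simp: S_monoid_def Id_sum_def)

lemma S_closed: "S \<subseteq> carrier D.F"
  unfolding S_eq Id_sum_def by (intro image_subsetI D.F.M.finsum_closed funcsetI Id_choice_closed)

text \<open>A choice function is constrained on \<open>Ob D\<close> only; restricting it there keeps
  the element of \<open>S\<close> and leaves finitely many functions. Finiteness prevents the sums
  over \<open>S\<close> in \<open>augmentation\<close> from collapsing to their default
  value.\<close>

lemma finite_S: "finite S"
proof -
  have "S \<subseteq> Id_sum ` (\<Pi>\<^sub>E x \<in> Ob D. Mor D)"
  proof
    fix s assume "s \<in> S"
    then obtain \<phi> where \<phi>: "\<phi> \<in> Id_choice" "s = Id_sum \<phi>" unfolding S_eq by blast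
    have "Id_sum (restrict \<phi> (Ob D)) = Id_sum \<phi>"
      unfolding Id_sum_def using Id_choice_closed[OF \<phi>(1)]
      by (intro D.F.M.finsum_cong') auto
    moreover have "restrict \<phi> (Ob D) \<in> (\<Pi>\<^sub>E x \<in> Ob D. Mor D)"
      using \<phi>(1) Id_class(1) by auto
    ultimately show "s \<in> Id_sum ` (\<Pi>\<^sub>E x \<in> Ob D. Mor D)" using \<phi>(2) by (metis imageI)
  qed
  then show ?thesis
    by (rule finite_subset) (intro finite_imageI finite_PiE D.finite_Ob D.finite_Mor)
qed

lemma linear_map_Id_sum:
  assumes "linear_map K D.F N h" "\<phi> \<in> Id_choice"
  shows "h (Id_sum \<phi>) = (\<Oplus>\<^bsub>N\<^esub>x \<in> Ob D. h (D.e (\<phi> x)))"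
  unfolding Id_sum_def using Id_choice_closed[OF assms(2)]
  by (intro linear_map.hom_finsum[OF assms(1) D.finite_Ob]) auto

lemma finsum_single_object:
  assumes "abelian_monoid M" "y \<in> Ob D" "v \<in> carrier M"
    "\<And>x. x \<in> Ob D \<Longrightarrow> u x = (if y = x then v else \<zero>\<^bsub>M\<^esub>)"
  shows "(\<Oplus>\<^bsub>M\<^esub>x \<in> Ob D. u x) = v"
proof -
  interpret M: abelian_monoid M by fact
  have "(\<Oplus>\<^bsub>M\<^esub>x \<in> Ob D. u x) = (\<Oplus>\<^bsub>M\<^esub>x \<in> Ob D. if y = x then v else \<zero>\<^bsub>M\<^esub>)"
    using assms(3,4) by (intro M.finsum_cong') auto
  also have "\<dots> = v"
    using M.finsum_singleton[OF assms(2) D.finite_Ob, of "\<lambda>_. v"] assms(3) by auto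
  finally show ?thesis .
qed

text \<open>Since \<open>\<phi> x\<close> is an endomorphism of \<open>x\<close>, only the summand
  at the target of \<open>f\<close> composes with \<open>f\<close>; the others contribute
  zero.\<close>

lemma Id_sum_mult:
  assumes \<phi>: "\<phi> \<in> Id_choice" and f: "f \<in> Mor D"
  shows "Id_sum \<phi> \<otimes>\<^bsub>D.alg\<^esub> D.e f = D.e (cmp D (\<phi> (tgt D f)) f)"
proof -
  have \<phi>M: "\<phi> x \<in> Mor D" "src D (\<phi> x) = x" if "x \<in> Ob D" for x
    using that \<phi> Id_class by auto
  have "Id_sum \<phi> \<otimes>\<^bsub>D.alg\<^esub> D.e f = (\<Oplus>\<^bsub>D.F\<^esub>x \<in> Ob D. D.e (\<phi> x) \<otimes>\<^bsub>D.alg\<^esub> D.e f)"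
    by (rule linear_map_Id_sum[OF D.linear_map_alg_mult_right[OF D.e_closed[OF f]] \<phi>])
  also have "\<dots> = D.e (cmp D (\<phi> (tgt D f)) f)"
  proof (rule finsum_single_object[OF D.F.M.abelian_monoid_axioms D.category_axioms(2)[OF f]])
    show "D.e (cmp D (\<phi> (tgt D f)) f) \<in> carrier D.F"
      using f by (intro D.e_closed D.category_axioms \<phi>M) auto
    show "D.e (\<phi> x) \<otimes>\<^bsub>D.alg\<^esub> D.e f
        = (if tgt D f = x then D.e (cmp D (\<phi> (tgt D f)) f) else \<zero>\<^bsub>D.F\<^esub>)" if "x \<in> Ob D" for x
      using D.basis_mult[OF \<phi>M(1)[OF that] f] \<phi>M(2)[OF that] by auto
  qed
  finally show ?thesis .
qed

lemma mult_Id_sum: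
  assumes \<phi>: "\<phi> \<in> Id_choice" and f: "f \<in> Mor D"
  shows "D.e f \<otimes>\<^bsub>D.alg\<^esub> Id_sum \<phi> = D.e (cmp D f (\<phi> (src D f)))"
proof -
  have \<phi>M: "\<phi> x \<in> Mor D" "tgt D (\<phi> x) = x" if "x \<in> Ob D" for x
    using that \<phi> Id_class by auto
  have "D.e f \<otimes>\<^bsub>D.alg\<^esub> Id_sum \<phi> = (\<Oplus>\<^bsub>D.F\<^esub>x \<in> Ob D. D.e f \<otimes>\<^bsub>D.alg\<^esub> D.e (\<phi> x))"
    by (rule linear_map_Id_sum[OF D.linear_map_alg_mult_left[OF D.e_closed[OF f]] \<phi>])
  also have "\<dots> = D.e (cmp D f (\<phi> (src D f)))"
  proof (rule finsum_single_object[OF D.F.M.abelian_monoid_axioms D.category_axioms(1)[OF f]])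
    show "D.e (cmp D f (\<phi> (src D f))) \<in> carrier D.F"
      using f by (intro D.e_closed D.category_axioms \<phi>M) (auto simp: \<phi>M D.category_axioms)
    show "D.e f \<otimes>\<^bsub>D.alg\<^esub> D.e (\<phi> x)
        = (if src D f = x then D.e (cmp D f (\<phi> (src D f))) else \<zero>\<^bsub>D.F\<^esub>)" if "x \<in> Ob D" for x
      using D.basis_mult[OF f \<phi>M(1)[OF that]] \<phi>M(2)[OF that] by auto
  qed
  finally show ?thesis .
qed

section \<open>The augmentation\<close>

abbreviation aug where "aug \<equiv> augmentation K D sm"

lemma S_span_eq: "S_span K D sm = linear_span K D.F S"
  by (simp add: S_span_def)

lemma S_span_closed: "S_span K D sm \<subseteq> carrier D.F"
  unfolding S_span_eq by (intro D.F.submoduleE D.F.linear_span_submodule S_closed)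

text \<open>The choice in \<open>augmentation\<close> comes with a combination that witnesses it.
  Keeping its coefficients \<open>u\<close> next to the chosen value lets later arguments compute
  with that very combination.\<close>

lemma augmentation_combination:
  assumes "r \<in> S_span K D sm"
  obtains u where "u \<in> S \<rightarrow> carrier K" "r = (\<Oplus>\<^bsub>D.F\<^esub>s \<in> S. u s \<odot>\<^bsub>D.F\<^esub> s)"
    "aug r = (\<Oplus>s \<in> S. u s)"
proof -
  have "\<exists>q. \<exists>u \<in> S \<rightarrow> carrier K. r = (\<Oplus>\<^bsub>D.F\<^esub>s \<in> S. u s \<odot>\<^bsub>D.F\<^esub> s) \<and> q = (\<Oplus>s \<in> S. u s)"
    using D.F.linear_span_finite[OF finite_S S_closed] assms unfolding S_span_eq by blast
  from someI_ex[OF this] show ?thesis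
    using that unfolding augmentation_def category_algebra_simps by blast
qed

lemma augmentation_closed: "r \<in> S_span K D sm \<Longrightarrow> aug r \<in> carrier K"
  by (elim augmentation_combination) (simp add: A.K.finsum_closed)

lemma S_subset_span: "S \<subseteq> S_span K D sm"
  unfolding S_span_eq by (rule D.F.linear_span_superset)

text \<open>The coefficients at the morphisms in \<open>Id_class D sm x\<close> add up to \<open>1\<close> on every element
  of \<open>S\<close>, so the functional \<open>\<epsilon>\<close> below extends the augmentation.\<close>

lemma augmentation_S:
  assumes "Ob D \<noteq> {}" "s \<in> S"
  shows "aug s = \<one>"
proof -
  obtain x where x: "x \<in> Ob D" using assms(1) by blast
  let ?k = "regular_module K"
  interpret k: module K ?k by (rule A.module_regular_module)
  have k_simps: "carrier ?k = carrier K" "\<zero>\<^bsub>?k\<^esub> = \<zero>" "smult ?k = mult K"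
    by (simp_all add: regular_module_def)
  define i where "i g = (if g \<in> Id_class D sm x then \<one> else \<zero>)" for g
  have i: "i \<in> Mor D \<rightarrow> carrier ?k" by (simp add: i_def k_simps)
  define \<epsilon> where "\<epsilon> = lin_ext K ?k i"
  interpret \<epsilon>: linear_map K D.F ?k \<epsilon>
    unfolding \<epsilon>_def by (rule k.linear_map_lin_ext[OF i])
  have \<epsilon>S: "\<epsilon> t = \<one>" if t: "t \<in> S" for t
  proof -
    obtain \<phi> where \<phi>: "\<phi> \<in> Id_choice" "t = Id_sum \<phi>" using t unfolding S_eq by blast
    have "\<epsilon> t = (\<Oplus>\<^bsub>?k\<^esub>y \<in> Ob D. \<epsilon> (D.e (\<phi> y)))"
      unfolding \<phi>(2) by (rule linear_map_Id_sum[OF \<epsilon>.linear_map_axioms \<phi>(1)])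
    also have "\<dots> = \<one>"
    proof (rule finsum_single_object[OF k.M.abelian_monoid_axioms x])
      fix y assume y: "y \<in> Ob D"
      have \<phi>y: "\<phi> y \<in> Id_class D sm y" using \<phi>(1) y by blast
      then have "\<epsilon> (D.e (\<phi> y)) = i (\<phi> y)"
        unfolding \<epsilon>_def using Id_class(1)[OF y] by (intro k.lin_ext_basis_elt[OF i])
      \<comment> \<open>If \<open>\<phi> y\<close> belongs to the class of \<open>x\<close> too, its
        source is both \<open>x\<close> and \<open>y\<close>; hence only the summand at
        \<open>x\<close> survives.\<close>
      also have "\<dots> = (if x = y then \<one> else \<zero>)"
        using \<phi>y Id_class(3)[OF x] Id_class(3)[OF y] unfolding i_def by auto
      finally show "\<epsilon> (D.e (\<phi> y)) = (if x = y then \<one> else \<zero>\<^bsub>?k\<^esub>)" by (simp add: k_simps)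
    qed (simp add: k_simps)
    finally show ?thesis .
  qed
  have "s \<in> S_span K D sm" using assms(2) S_subset_span by blast
  then obtain u where u: "u \<in> S \<rightarrow> carrier K" "s = (\<Oplus>\<^bsub>D.F\<^esub>t \<in> S. u t \<odot>\<^bsub>D.F\<^esub> t)"
    "aug s = (\<Oplus>t \<in> S. u t)" by (rule augmentation_combination)
  \<comment> \<open>A functional equal to 1 on all of \<open>S\<close> turns the combination behind
    \<open>aug s\<close> into its coefficient sum.\<close>
  have "\<epsilon> s = \<epsilon> (\<Oplus>\<^bsub>D.F\<^esub>t \<in> S. u t \<odot>\<^bsub>D.F\<^esub> t)" using u(2) by (rule arg_cong)
  also have "\<dots> = (\<Oplus>t \<in> S. \<epsilon> (u t \<odot>\<^bsub>D.F\<^esub> t))"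
    using u(1) S_closed finite_S by (subst \<epsilon>.hom_finsum) auto
  also have "\<dots> = (\<Oplus>t \<in> S. u t)"
  proof (rule A.K.finsum_cong')
    fix t assume t: "t \<in> S"
    then have "\<epsilon> (u t \<odot>\<^bsub>D.F\<^esub> t) = u t \<odot>\<^bsub>?k\<^esub> \<epsilon> t"
      using u(1) S_closed by (intro \<epsilon>.hom_smult) auto
    also have "\<dots> = u t" using \<epsilon>S[OF t] funcset_mem[OF u(1) t] by (simp add: k_simps)
    finally show "\<epsilon> (u t \<odot>\<^bsub>D.F\<^esub> t) = u t" .
  qed (use u(1) in auto)
  finally show ?thesis using u(3) \<epsilon>S[OF assms(2)] by simp
qed

section \<open>The structural homomorphism and the right ideal J\<close>

sublocale \<sigma>: linear_map K D.F A \<sigma>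
  using interior
  by unfold_locales (auto simp: interior_algebra_def algebra_hom_def ring_hom_def)

lemma \<sigma>_mult: "\<lbrakk>a \<in> carrier D.F; b \<in> carrier D.F\<rbrakk> \<Longrightarrow> \<sigma> (a \<otimes>\<^bsub>D.alg\<^esub> b) = \<sigma> a \<otimes>\<^bsub>A\<^esub> \<sigma> b"
  using interior by (auto simp: interior_algebra_def algebra_hom_def ring_hom_def)

lemma \<sigma>_one: "\<sigma> (\<Oplus>\<^bsub>D.F\<^esub>x \<in> Ob D. D.e (idt D x)) = \<one>\<^bsub>A\<^esub>"
  using interior
  by (auto simp: interior_algebra_def algebra_hom_def ring_hom_def category_algebra_one)

lemma \<sigma>_S_closed: "s \<in> S \<Longrightarrow> \<sigma> s \<in> carrier A"
  using S_closed \<sigma>.hom_closed by blast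

text \<open>Without objects the identity of kD is an empty sum, so its image 1 in \<open>A\<close>
  is 0. This disposes of the case in which the augmentation has an arbitrary value at 0.\<close>

lemma trivial_if_no_objects:
  assumes "Ob D = {}" "c \<in> carrier A"
  shows "c = \<zero>\<^bsub>A\<^esub>"
proof -
  have "\<one>\<^bsub>A\<^esub> = \<zero>\<^bsub>A\<^esub>" using \<sigma>_one \<sigma>.hom_zero by (simp add: assms(1))
  then show ?thesis using assms(2) A.l_one[of c] by simp
qed

text \<open>Because \<open>c\<close> runs through all of \<open>A\<close>, this linear span is
  already a right ideal. Its generators are the differences that the balancing relation over kS
  forces to vanish.\<close>

definition J :: "'a set" where
  "J = linear_span K A {\<sigma> s \<otimes>\<^bsub>A\<^esub> c \<ominus>\<^bsub>A\<^esub> c | s c. s \<in> S \<and> c \<in> carrier A}"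

lemma J_generators_closed:
  "{\<sigma> s \<otimes>\<^bsub>A\<^esub> c \<ominus>\<^bsub>A\<^esub> c | s c. s \<in> S \<and> c \<in> carrier A} \<subseteq> carrier A"
  by (clarify, intro A.M.minus_closed A.A.m_closed \<sigma>_S_closed)

lemma J_submodule: "submodule J K A"
  unfolding J_def by (rule A.linear_span_submodule) (rule J_generators_closed)

lemma J_generator: "\<lbrakk>s \<in> S; c \<in> carrier A\<rbrakk> \<Longrightarrow> \<sigma> s \<otimes>\<^bsub>A\<^esub> c \<ominus>\<^bsub>A\<^esub> c \<in> J"
  unfolding J_def by (rule subsetD[OF A.linear_span_superset]) blast

lemma J_minimal:
  assumes "submodule H K A" "\<And>s c. \<lbrakk>s \<in> S; c \<in> carrier A\<rbrakk> \<Longrightarrow> \<sigma> s \<otimes>\<^bsub>A\<^esub> c \<ominus>\<^bsub>A\<^esub> c \<in> H"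
  shows "J \<subseteq> H"
  unfolding J_def by (rule A.linear_span_minimal[OF assms(1)]) (use assms(2) in blast)

text \<open>Right multiplication by \<open>c\<close> sends the generator for \<open>s\<close> and
  \<open>d\<close> to the one for \<open>s\<close> and the product of \<open>d\<close> and
  \<open>c\<close>.\<close>

lemma J_right_ideal:
  assumes "j \<in> J" "c \<in> carrier A"
  shows "j \<otimes>\<^bsub>A\<^esub> c \<in> J"
proof -
  have "J \<subseteq> {x \<in> carrier A. x \<otimes>\<^bsub>A\<^esub> c \<in> J}"
  proof (rule J_minimal)
    show "submodule {x \<in> carrier A. x \<otimes>\<^bsub>A\<^esub> c \<in> J} K A"
      by (rule linear_map.vimage_submodule[OF A.linear_map_mult_right[OF assms(2)] J_submodule])
    fix s d assume s: "s \<in> S" and d: "d \<in> carrier A"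
    have "(\<sigma> s \<otimes>\<^bsub>A\<^esub> d \<ominus>\<^bsub>A\<^esub> d) \<otimes>\<^bsub>A\<^esub> c = \<sigma> s \<otimes>\<^bsub>A\<^esub> (d \<otimes>\<^bsub>A\<^esub> c) \<ominus>\<^bsub>A\<^esub> (d \<otimes>\<^bsub>A\<^esub> c)"
      using \<sigma>_S_closed[OF s] d assms(2)
      by (simp add: a_minus_def A.A.l_distr A.A.l_minus A.A.m_assoc)
    also have "\<dots> \<in> J" using s d assms(2) by (intro J_generator) auto
    finally show "\<sigma> s \<otimes>\<^bsub>A\<^esub> d \<ominus>\<^bsub>A\<^esub> d \<in> {x \<in> carrier A. x \<otimes>\<^bsub>A\<^esub> c \<in> J}"
      using \<sigma>_S_closed[OF s] d by simp
  qed
  then show ?thesis using assms(1) by blast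
qed

section \<open>The tensor module as the quotient by J\<close>

sublocale T: tensor_product K "regular_module K" A "S_span K D sm"
  "\<lambda>a r. a \<otimes>\<^bsub>K\<^esub> aug r" "\<lambda>r c. \<sigma> r \<otimes>\<^bsub>A\<^esub> c"
proof (intro tensor_product.intro tensor_product_axioms.intro A.module_regular_module A.module_axioms)
  show "m \<otimes>\<^bsub>K\<^esub> aug r \<in> carrier (regular_module K)"
    if "m \<in> carrier (regular_module K)" "r \<in> S_span K D sm" for m r
    using that augmentation_closed by (simp add: regular_module_def)
  show "\<sigma> r \<otimes>\<^bsub>A\<^esub> c \<in> carrier A" if "r \<in> S_span K D sm" "c \<in> carrier A" for r c
    using that S_span_closed \<sigma>.hom_closed by blast
qed

abbreviation "Q \<equiv> puig_tensor K D sm A \<sigma>"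
abbreviation "elt \<equiv> puig_elt K D sm A \<sigma>"

lemma puig_tensor_eq: "Q = T.T" and puig_elt_eq: "elt = T.t"
  by (simp_all add: puig_tensor_def puig_elt_def)

sublocale Q: module K Q
  unfolding puig_tensor_eq by (rule T.q.N.module_axioms)

text \<open>Under the identification of the tensor module with the quotient by \<open>J\<close>,
  this is the quotient map.\<close>

definition p :: "'a \<Rightarrow> ('k \<times> 'a \<Rightarrow> 'k) set" where
  "p c = elt \<one> c"

sublocale p: linear_map K A Q p
proof unfold_locales
  have one: "\<one> \<in> carrier (regular_module K)" by (simp add: regular_module_def)
  fix c assume c: "c \<in> carrier A"
  show "p c \<in> carrier Q"
    unfolding p_def puig_tensor_eq puig_elt_eq by (rule T.tensor_elt_closed[OF one c])
  show "p (c \<oplus>\<^bsub>A\<^esub> d) = p c \<oplus>\<^bsub>Q\<^esub> p d" if "d \<in> carrier A" for d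
    unfolding p_def puig_tensor_eq puig_elt_eq by (rule T.tensor_elt_add_right[OF one c that])
  show "p (r \<odot>\<^bsub>A\<^esub> c) = r \<odot>\<^bsub>Q\<^esub> p c" if "r \<in> carrier K" for r
    unfolding p_def puig_tensor_eq puig_elt_eq by (rule T.tensor_elt_smult_right[OF that one c])
qed

text \<open>The left factor is the field itself, so it can be moved across the tensor sign as a
  scalar; thus \<open>p\<close> reaches every single tensor.\<close>

lemma puig_elt_eq_p:
  assumes "a \<in> carrier K" "c \<in> carrier A"
  shows "elt a c = p (a \<odot>\<^bsub>A\<^esub> c)"
proof -
  have "elt a c = elt (a \<odot>\<^bsub>regular_module K\<^esub> \<one>) c"
    using assms by (simp add: regular_module_def)
  also have "\<dots> = a \<odot>\<^bsub>Q\<^esub> p c"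
    unfolding p_def puig_tensor_eq puig_elt_eq
    by (rule T.tensor_elt_smult_left) (use assms in \<open>simp_all add: regular_module_def\<close>)
  finally show ?thesis using assms by (simp add: p.hom_smult)
qed

lemma p_surj: "p ` carrier A = carrier Q"
proof
  show "p ` carrier A \<subseteq> carrier Q" using p.hom_closed by blast
  show "carrier Q \<subseteq> p ` carrier A"
    unfolding puig_tensor_eq
  proof (rule T.tensor_subset_submodule)
    show "submodule (p ` carrier A) K T.T"
      using p.image_submodule[OF A.carrier_is_submodule] by (simp add: puig_tensor_eq)
    show "T.t a c \<in> p ` carrier A" if "a \<in> carrier (regular_module K)" "c \<in> carrier A" for a c
      using that puig_elt_eq_p[of a c] by (simp add: regular_module_def puig_elt_eq)
  qed
qed

text \<open>The balancing relation for the element \<open>s\<close> of kS, read with augmentation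
  1.\<close>

lemma p_generator:
  assumes s: "s \<in> S" and c: "c \<in> carrier A"
  shows "p (\<sigma> s \<otimes>\<^bsub>A\<^esub> c) = p c"
proof (cases "Ob D = {}")
  \<comment> \<open>Here \<open>aug s\<close> may differ from 1, but \<open>A\<close> is
    zero.\<close>
  case True
  then show ?thesis
    using trivial_if_no_objects[OF True, of c] trivial_if_no_objects[OF True, of "\<sigma> s \<otimes>\<^bsub>A\<^esub> c"]
      \<sigma>_S_closed[OF s] c by simp
next
  case False
  have "elt (\<one> \<otimes>\<^bsub>K\<^esub> aug s) c = elt \<one> (\<sigma> s \<otimes>\<^bsub>A\<^esub> c)"
    unfolding puig_elt_eq using s c S_subset_span
    by (intro T.tensor_elt_balanced) (auto simp: regular_module_def)
  then show ?thesis by (simp add: augmentation_S[OF False s] p_def)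
qed

text \<open>The universal property yields a map \<open>h\<close> to \<open>?P\<close> with
  \<open>h (p c)\<close> equal to the class of \<open>c\<close>; so an element killed by
  \<open>p\<close> has class zero.\<close>

lemma p_ker_subset:
  assumes c: "c \<in> carrier A" and "p c = \<zero>\<^bsub>Q\<^esub>"
  shows "c \<in> J"
proof -
  let ?P = "quotient_module A J"
  let ?k = "regular_module K"
  have k: "carrier ?k = carrier K" "add ?k = add K" "smult ?k = mult K"
    by (simp_all add: regular_module_def)
  interpret P: module K ?P by (rule A.module_quotient_module[OF J_submodule])
  define \<pi> where "\<pi> x = J +>\<^bsub>A\<^esub> x" for x
  interpret \<pi>: linear_map K A ?P \<pi>
    unfolding \<pi>_def by (rule A.linear_map_coset[OF J_submodule])
  have \<pi>S: "\<pi> (\<sigma> s \<otimes>\<^bsub>A\<^esub> n) = \<pi> n" if "s \<in> S" "n \<in> carrier A" for s n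
    unfolding \<pi>_def using that J_generator[OF that] \<sigma>_S_closed[OF that(1)]
    by (subst A.quotient_module_coset(5)[OF J_submodule]) auto
  \<comment> \<open>This will be the balancing condition. Each \<open>s\<close> in \<open>S\<close>
    fixes classes modulo \<open>J\<close> by \<open>\<pi>S\<close>, so \<open>r\<close> multiplies
    them by the coefficient sum of the combination behind \<open>aug r\<close>.\<close>
  have \<pi>span: "\<pi> (\<sigma> r \<otimes>\<^bsub>A\<^esub> n) = aug r \<odot>\<^bsub>?P\<^esub> \<pi> n"
    if r: "r \<in> S_span K D sm" and n: "n \<in> carrier A" for r n
  proof -
    obtain u where u: "u \<in> S \<rightarrow> carrier K" "r = (\<Oplus>\<^bsub>D.F\<^esub>s \<in> S. u s \<odot>\<^bsub>D.F\<^esub> s)"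
      "aug r = (\<Oplus>s \<in> S. u s)" by (rule augmentation_combination[OF r])
    interpret h: linear_map K D.F ?P "\<lambda>r. \<pi> (\<sigma> r \<otimes>\<^bsub>A\<^esub> n)"
      by (rule linear_map_comp[OF linear_map_comp[OF \<sigma>.linear_map_axioms A.linear_map_mult_right[OF n]]
        \<pi>.linear_map_axioms])
    interpret g: linear_map K ?k ?P "\<lambda>r. r \<odot>\<^bsub>?P\<^esub> \<pi> n"
      by (rule P.linear_map_smult) (rule \<pi>.hom_closed[OF n])
    have "\<pi> (\<sigma> r \<otimes>\<^bsub>A\<^esub> n) = \<pi> (\<sigma> (\<Oplus>\<^bsub>D.F\<^esub>s \<in> S. u s \<odot>\<^bsub>D.F\<^esub> s) \<otimes>\<^bsub>A\<^esub> n)"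
      using u(2) by (rule arg_cong)
    also have "\<dots> = (\<Oplus>\<^bsub>?P\<^esub>s \<in> S. \<pi> (\<sigma> (u s \<odot>\<^bsub>D.F\<^esub> s) \<otimes>\<^bsub>A\<^esub> n))"
      using u(1) S_closed by (intro h.hom_finsum finite_S) auto
    also have "\<dots> = (\<Oplus>\<^bsub>?P\<^esub>s \<in> S. u s \<odot>\<^bsub>?P\<^esub> \<pi> n)"
    proof (rule P.M.finsum_cong'[OF refl])
      show "(\<lambda>s. u s \<odot>\<^bsub>?P\<^esub> \<pi> n) \<in> S \<rightarrow> carrier ?P"
        using u(1) \<pi>.hom_closed[OF n] by auto
      fix s assume s: "s \<in> S"
      have "\<pi> (\<sigma> (u s \<odot>\<^bsub>D.F\<^esub> s) \<otimes>\<^bsub>A\<^esub> n) = u s \<odot>\<^bsub>?P\<^esub> \<pi> (\<sigma> s \<otimes>\<^bsub>A\<^esub> n)"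
        using u(1) S_closed s by (intro h.hom_smult) auto
      then show "\<pi> (\<sigma> (u s \<odot>\<^bsub>D.F\<^esub> s) \<otimes>\<^bsub>A\<^esub> n) = u s \<odot>\<^bsub>?P\<^esub> \<pi> n"
        using \<pi>S[OF s n] by simp
    qed
    also have "\<dots> = (\<Oplus>\<^bsub>?k\<^esub>s \<in> S. u s) \<odot>\<^bsub>?P\<^esub> \<pi> n"
      using u(1) by (intro g.hom_finsum[symmetric] finite_S) (auto simp: k)
    finally show ?thesis by (simp add: u(3))
  qed
  obtain h where h: "linear_map K T.T ?P h"
    "\<And>a n. \<lbrakk>a \<in> carrier ?k; n \<in> carrier A\<rbrakk> \<Longrightarrow> h (T.t a n) = a \<odot>\<^bsub>?P\<^esub> \<pi> n"
  proof (rule T.tensor_lift[OF P.module_axioms, of "\<lambda>a n. a \<odot>\<^bsub>?P\<^esub> \<pi> n"])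
    fix m r n
    assume "m \<in> carrier ?k" and r: "r \<in> S_span K D sm" and n: "n \<in> carrier A"
    then show "(m \<otimes>\<^bsub>K\<^esub> aug r) \<odot>\<^bsub>?P\<^esub> \<pi> n = m \<odot>\<^bsub>?P\<^esub> \<pi> (\<sigma> r \<otimes>\<^bsub>A\<^esub> n)"
      unfolding \<pi>span[OF r n] k
      by (intro P.smult_assoc1 augmentation_closed \<pi>.hom_closed)
  next
    fix a m n assume "a \<in> carrier K" "m \<in> carrier ?k" "n \<in> carrier A"
    then show "m \<odot>\<^bsub>?P\<^esub> \<pi> (a \<odot>\<^bsub>A\<^esub> n) = a \<odot>\<^bsub>?P\<^esub> (m \<odot>\<^bsub>?P\<^esub> \<pi> n)"
      unfolding k
      by (simp add: \<pi>.hom_smult \<pi>.hom_closed A.K.m_comm flip: P.smult_assoc1)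
  qed (auto simp: k \<pi>.hom_add \<pi>.hom_closed P.smult_l_distr P.smult_r_distr P.smult_assoc1)
  have "h (p c) = \<one> \<odot>\<^bsub>?P\<^esub> \<pi> c"
    unfolding p_def puig_elt_eq by (rule h(2)) (simp_all add: k c)
  then have "\<pi> c = \<zero>\<^bsub>?P\<^esub>"
    using linear_map.hom_zero[OF h(1)] assms \<pi>.hom_closed[OF c] by (simp add: puig_tensor_eq)
  then show ?thesis
    unfolding \<pi>_def using A.coset_eq_zero_iff[OF J_submodule c] by simp
qed

text \<open>The kernel of \<open>p\<close> is exactly \<open>J\<close>: one inclusion is
  \<open>p_ker_subset\<close>, the other follows from \<open>p_generator\<close> on the
  generators.\<close>

lemma p_eq_iff:
  assumes "c \<in> carrier A" "d \<in> carrier A"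
  shows "p c = p d \<longleftrightarrow> c \<ominus>\<^bsub>A\<^esub> d \<in> J"
proof
  assume "p c = p d"
  then have "p (c \<ominus>\<^bsub>A\<^esub> d) = \<zero>\<^bsub>Q\<^esub>"
    unfolding p.hom_minus[OF assms]
    using Q.M.minus_self[OF p.hom_closed[OF assms(2)]] by (simp only:)
  then show "c \<ominus>\<^bsub>A\<^esub> d \<in> J" using assms by (intro p_ker_subset) auto
next
  assume *: "c \<ominus>\<^bsub>A\<^esub> d \<in> J"
  have "J \<subseteq> {x \<in> carrier A. p x \<in> {\<zero>\<^bsub>Q\<^esub>}}"
  proof (intro J_minimal p.vimage_submodule Q.zero_submodule)
    fix s x assume s: "s \<in> S" and x: "x \<in> carrier A"
    have sx: "\<sigma> s \<otimes>\<^bsub>A\<^esub> x \<in> carrier A" using \<sigma>_S_closed[OF s] x by simp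
    have "p (\<sigma> s \<otimes>\<^bsub>A\<^esub> x \<ominus>\<^bsub>A\<^esub> x) = \<zero>\<^bsub>Q\<^esub>"
      unfolding p.hom_minus[OF sx x] p_generator[OF s x]
      by (rule Q.M.minus_self[OF p.hom_closed[OF x]])
    then show "\<sigma> s \<otimes>\<^bsub>A\<^esub> x \<ominus>\<^bsub>A\<^esub> x \<in> {x \<in> carrier A. p x \<in> {\<zero>\<^bsub>Q\<^esub>}}"
      using sx x by simp
  qed
  with * have "p (c \<ominus>\<^bsub>A\<^esub> d) = \<zero>\<^bsub>Q\<^esub>" by blast
  then show "p c = p d"
    unfolding p.hom_minus[OF assms] by (rule Q.M.minus_eqD) (intro p.hom_closed assms)+
qed

text \<open>\<open>J\<close> is a right ideal. Therefore the right action of \<open>S\<close> does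
  not depend on the tensor by which an element is written.\<close>

lemma p_mult_right:
  assumes "c \<in> carrier A" "d \<in> carrier A" "p c = p d" "x \<in> carrier A"
  shows "p (c \<otimes>\<^bsub>A\<^esub> x) = p (d \<otimes>\<^bsub>A\<^esub> x)"
proof -
  have "(c \<ominus>\<^bsub>A\<^esub> d) \<otimes>\<^bsub>A\<^esub> x \<in> J"
    using assms p_eq_iff J_right_ideal by blast
  then show ?thesis
    using assms p_eq_iff[of "c \<otimes>\<^bsub>A\<^esub> x" "d \<otimes>\<^bsub>A\<^esub> x"]
    by (simp add: a_minus_def A.A.l_distr A.A.l_minus)
qed

lemma puig_act_p:
  assumes c: "c \<in> carrier A" and s: "s \<in> S"
  shows "puig_act K D sm A \<sigma> (p c) s = p (c \<otimes>\<^bsub>A\<^esub> \<sigma> s)"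
  unfolding puig_act_def
proof (rule the_equality)
  note ss = \<sigma>_S_closed[OF s]
  show "\<forall>a\<in>carrier K. \<forall>d\<in>carrier A. p c = elt a d \<longrightarrow>
      p (c \<otimes>\<^bsub>A\<^esub> \<sigma> s) = elt a (d \<otimes>\<^bsub>A\<^esub> \<sigma> s)"
  proof (intro ballI impI)
    fix a d assume ad: "a \<in> carrier K" "d \<in> carrier A" "p c = elt a d"
    then have "p (c \<otimes>\<^bsub>A\<^esub> \<sigma> s) = p ((a \<odot>\<^bsub>A\<^esub> d) \<otimes>\<^bsub>A\<^esub> \<sigma> s)"
      using c ss by (intro p_mult_right) (auto simp: puig_elt_eq_p)
    then show "p (c \<otimes>\<^bsub>A\<^esub> \<sigma> s) = elt a (d \<otimes>\<^bsub>A\<^esub> \<sigma> s)"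
      using ad ss by (simp add: puig_elt_eq_p A.smult_mult_left)
  qed
  fix w
  assume w: "\<forall>a\<in>carrier K. \<forall>d\<in>carrier A. p c = elt a d \<longrightarrow> w = elt a (d \<otimes>\<^bsub>A\<^esub> \<sigma> s)"
  \<comment> \<open>The representation with \<open>a = 1\<close> and \<open>d = c\<close> determines
    \<open>w\<close>.\<close>
  show "w = p (c \<otimes>\<^bsub>A\<^esub> \<sigma> s)"
    using bspec[OF bspec[OF w A.K.one_closed] c] by (simp add: p_def)
qed

section \<open>The idealizer I\<close>

definition I :: "'a set" where
  "I = {c \<in> carrier A. \<forall>s\<in>S. p (c \<otimes>\<^bsub>A\<^esub> \<sigma> s) = p c}"

lemma I_closed: "c \<in> I \<Longrightarrow> c \<in> carrier A"
  by (simp add: I_def)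

text \<open>Membership depends on the image under \<open>p\<close> only, so every representative of
  a fixed point lies in \<open>I\<close>, not just a suitable one.\<close>

lemma I_cong:
  assumes "c \<in> I" "d \<in> carrier A" "p c = p d"
  shows "d \<in> I"
proof -
  have "p (d \<otimes>\<^bsub>A\<^esub> \<sigma> s) = p d" if s: "s \<in> S" for s
  proof -
    have "p (d \<otimes>\<^bsub>A\<^esub> \<sigma> s) = p (c \<otimes>\<^bsub>A\<^esub> \<sigma> s)"
      by (rule p_mult_right[OF I_closed[OF assms(1)] assms(2,3) \<sigma>_S_closed[OF s], symmetric])
    also have "\<dots> = p c" using assms(1) s by (simp add: I_def)
    finally show ?thesis unfolding assms(3) .
  qed
  then show ?thesis using assms(2) by (simp add: I_def)
qed

text \<open>On generators, c (\<sigma> s d - d) = (c \<sigma> s - c) d; the bracket lies in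
  \<open>J\<close> because \<open>c\<close> is in \<open>I\<close>, and \<open>J\<close> is a right
  ideal.\<close>

lemma I_mult_J:
  assumes "c \<in> I" "j \<in> J"
  shows "c \<otimes>\<^bsub>A\<^esub> j \<in> J"
proof -
  note c = I_closed[OF assms(1)]
  have "J \<subseteq> {x \<in> carrier A. c \<otimes>\<^bsub>A\<^esub> x \<in> J}"
  proof (rule J_minimal)
    show "submodule {x \<in> carrier A. c \<otimes>\<^bsub>A\<^esub> x \<in> J} K A"
      by (rule linear_map.vimage_submodule[OF A.linear_map_mult_left[OF c] J_submodule])
    fix s d assume s: "s \<in> S" and d: "d \<in> carrier A"
    note ss = \<sigma>_S_closed[OF s]
    have "c \<otimes>\<^bsub>A\<^esub> \<sigma> s \<ominus>\<^bsub>A\<^esub> c \<in> J"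
      using assms(1) s c ss p_eq_iff[of "c \<otimes>\<^bsub>A\<^esub> \<sigma> s" c] by (simp add: I_def)
    then have "(c \<otimes>\<^bsub>A\<^esub> \<sigma> s \<ominus>\<^bsub>A\<^esub> c) \<otimes>\<^bsub>A\<^esub> d \<in> J" using d by (rule J_right_ideal)
    also have "(c \<otimes>\<^bsub>A\<^esub> \<sigma> s \<ominus>\<^bsub>A\<^esub> c) \<otimes>\<^bsub>A\<^esub> d = c \<otimes>\<^bsub>A\<^esub> (\<sigma> s \<otimes>\<^bsub>A\<^esub> d \<ominus>\<^bsub>A\<^esub> d)"
      using c d ss
      by (simp add: a_minus_def A.A.l_distr A.A.r_distr A.A.l_minus A.A.r_minus A.A.m_assoc)
    finally show "\<sigma> s \<otimes>\<^bsub>A\<^esub> d \<ominus>\<^bsub>A\<^esub> d \<in> {x \<in> carrier A. c \<otimes>\<^bsub>A\<^esub> x \<in> J}"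
      using ss d by simp
  qed
  then show ?thesis using assms(2) by blast
qed

text \<open>Left multiplication by an element of \<open>I\<close> preserves \<open>J\<close> and
  therefore descends to the tensor module.\<close>

lemma p_mult_left:
  assumes "c \<in> I" "x \<in> carrier A" "y \<in> carrier A" "p x = p y"
  shows "p (c \<otimes>\<^bsub>A\<^esub> x) = p (c \<otimes>\<^bsub>A\<^esub> y)"
proof -
  note c = I_closed[OF assms(1)]
  have "c \<otimes>\<^bsub>A\<^esub> (x \<ominus>\<^bsub>A\<^esub> y) \<in> J"
    using assms p_eq_iff I_mult_J by blast
  then show ?thesis
    using assms c p_eq_iff[of "c \<otimes>\<^bsub>A\<^esub> x" "c \<otimes>\<^bsub>A\<^esub> y"]
    by (simp add: a_minus_def A.A.r_distr A.A.r_minus)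
qed

lemma I_submodule: "submodule I K A"
proof (intro A.submoduleI)
  show "\<zero>\<^bsub>A\<^esub> \<in> I" using \<sigma>_S_closed by (simp add: I_def)
  show "\<ominus>\<^bsub>A\<^esub> c \<in> I" if "c \<in> I" for c
    using that \<sigma>_S_closed by (simp add: I_def A.A.l_minus p.hom_a_inv)
  show "c \<oplus>\<^bsub>A\<^esub> d \<in> I" if "c \<in> I" "d \<in> I" for c d
    using that \<sigma>_S_closed by (simp add: I_def A.A.l_distr p.hom_add)
  show "r \<odot>\<^bsub>A\<^esub> c \<in> I" if "r \<in> carrier K" "c \<in> I" for r c
    using that \<sigma>_S_closed by (simp add: I_def A.smult_mult_left p.hom_smult)
qed (auto simp: I_def)

lemma I_mult:
  assumes "c \<in> I" "d \<in> I"
  shows "c \<otimes>\<^bsub>A\<^esub> d \<in> I"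
proof -
  note cd = I_closed[OF assms(1)] I_closed[OF assms(2)]
  have "p (c \<otimes>\<^bsub>A\<^esub> d \<otimes>\<^bsub>A\<^esub> \<sigma> s) = p (c \<otimes>\<^bsub>A\<^esub> d)" if s: "s \<in> S" for s
  proof -
    have "p (c \<otimes>\<^bsub>A\<^esub> d \<otimes>\<^bsub>A\<^esub> \<sigma> s) = p (c \<otimes>\<^bsub>A\<^esub> (d \<otimes>\<^bsub>A\<^esub> \<sigma> s))"
      using cd \<sigma>_S_closed[OF s] by (simp add: A.A.m_assoc)
    \<comment> \<open>The images of d \<sigma> s and d agree since \<open>d\<close> is in
      \<open>I\<close>; left multiplication by \<open>c\<close> respects this since \<open>c\<close>
      is in \<open>I\<close>.\<close>
    also have "\<dots> = p (c \<otimes>\<^bsub>A\<^esub> d)"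
      using assms s cd \<sigma>_S_closed[OF s] by (intro p_mult_left) (auto simp: I_def)
    finally show ?thesis .
  qed
  then show ?thesis using cd by (simp add: I_def)
qed

text \<open>For the identity, invariance compares \<sigma> s with 1, which is
  \<open>p_generator\<close> at 1.\<close>

lemma I_one: "\<one>\<^bsub>A\<^esub> \<in> I"
  using p_generator[of _ "\<one>\<^bsub>A\<^esub>"] \<sigma>_S_closed by (simp add: I_def)

section \<open>The algebra structure on IndP\<close>

abbreviation "P \<equiv> IndP K D sm A \<sigma>"

lemma IndP_simps:
  "carrier P = p ` I" "add P = add Q" "\<zero>\<^bsub>P\<^esub> = \<zero>\<^bsub>Q\<^esub>" "smult P = smult Q"
  "mult P = puig_mult K D sm A \<sigma>" "\<one>\<^bsub>P\<^esub> = p \<one>\<^bsub>A\<^esub>"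
proof -
  show "carrier P = p ` I"
    by (auto simp: IndP_def I_def puig_act_p p_surj[symmetric])
qed (simp_all add: IndP_def p_def)

lemma puig_mult_p:
  assumes c: "c \<in> I" and d: "d \<in> I"
  shows "p c \<otimes>\<^bsub>P\<^esub> p d = p (c \<otimes>\<^bsub>A\<^esub> d)"
  unfolding IndP_simps puig_mult_def
proof (rule the_equality)
  note cA = I_closed[OF c] and dA = I_closed[OF d]
  show "\<forall>a1\<in>carrier K. \<forall>a2\<in>carrier K. \<forall>c1\<in>carrier A. \<forall>c2\<in>carrier A.
      p c = elt a1 c1 \<longrightarrow> p d = elt a2 c2 \<longrightarrow>
      p (c \<otimes>\<^bsub>A\<^esub> d) = elt (a1 \<otimes>\<^bsub>K\<^esub> a2) (c1 \<otimes>\<^bsub>A\<^esub> c2)"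
  proof (intro ballI impI)
    fix a1 a2 c1 c2
    assume a: "a1 \<in> carrier K" "a2 \<in> carrier K" "c1 \<in> carrier A" "c2 \<in> carrier A"
      and e: "p c = elt a1 c1" "p d = elt a2 c2"
    \<comment> \<open>The order of replacement matters: the right factor is exchanged while the left
      one is still \<open>c\<close>, an element of \<open>I\<close>; after that the left factor may
      be exchanged for any representative.\<close>
    have "p (c \<otimes>\<^bsub>A\<^esub> d) = p (c \<otimes>\<^bsub>A\<^esub> (a2 \<odot>\<^bsub>A\<^esub> c2))"
      using a e c dA by (intro p_mult_left) (auto simp: puig_elt_eq_p)
    also have "\<dots> = p ((a1 \<odot>\<^bsub>A\<^esub> c1) \<otimes>\<^bsub>A\<^esub> (a2 \<odot>\<^bsub>A\<^esub> c2))"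
      using a e cA by (intro p_mult_right) (auto simp: puig_elt_eq_p)
    also have "\<dots> = elt (a1 \<otimes>\<^bsub>K\<^esub> a2) (c1 \<otimes>\<^bsub>A\<^esub> c2)"
      using a by (simp add: puig_elt_eq_p A.smult_mult_smult)
    finally show "p (c \<otimes>\<^bsub>A\<^esub> d) = elt (a1 \<otimes>\<^bsub>K\<^esub> a2) (c1 \<otimes>\<^bsub>A\<^esub> c2)" .
  qed
  fix w
  assume w: "\<forall>a1\<in>carrier K. \<forall>a2\<in>carrier K. \<forall>c1\<in>carrier A. \<forall>c2\<in>carrier A.
      p c = elt a1 c1 \<longrightarrow> p d = elt a2 c2 \<longrightarrow> w = elt (a1 \<otimes>\<^bsub>K\<^esub> a2) (c1 \<otimes>\<^bsub>A\<^esub> c2)"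
  have "w = elt (\<one> \<otimes>\<^bsub>K\<^esub> \<one>) (c \<otimes>\<^bsub>A\<^esub> d)"
    using w cA dA by (simp only: p_def A.K.one_closed)
  then show "w = p (c \<otimes>\<^bsub>A\<^esub> d)" by (simp add: p_def)
qed

text \<open>\<open>p\<close> maps the subalgebra \<open>I\<close> onto \<open>IndP\<close> and
  respects all operations, so the laws are inherited without forming the quotient of
  \<open>I\<close> by \<open>J\<close>.\<close>

lemma assoc_algebra_IndP: "assoc_algebra K P"
proof (rule assoc_algebra_image[where h = p])
  show "assoc_algebra K (A\<lparr>carrier := I\<rparr>)"
    by (rule A.subalgebra[OF I_submodule I_one I_mult])
qed (simp_all add: IndP_simps(1-4,6) puig_mult_p p.hom_add p.hom_smult p.hom_zero I_closed)

text \<open>Membership in \<open>carrier P\<close> provides only some element of \<open>I\<close>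
  with the given image; \<open>I_cong\<close> passes to the representative at hand, so that
  \<open>puig_mult_p\<close> applies.\<close>

lemma IndP_mult:
  assumes "a1 \<in> carrier K" "a2 \<in> carrier K" "c1 \<in> carrier A" "c2 \<in> carrier A"
    and "elt a1 c1 \<in> carrier P" "elt a2 c2 \<in> carrier P"
  shows "elt a1 c1 \<otimes>\<^bsub>P\<^esub> elt a2 c2 = elt (a1 \<otimes>\<^bsub>K\<^esub> a2) (c1 \<otimes>\<^bsub>A\<^esub> c2)"
proof -
  have "a \<odot>\<^bsub>A\<^esub> c \<in> I" if "a \<in> carrier K" "c \<in> carrier A" "elt a c \<in> carrier P" for a c
    using that I_cong by (auto simp: IndP_simps puig_elt_eq_p)
  then have "elt a1 c1 \<otimes>\<^bsub>P\<^esub> elt a2 c2 = p ((a1 \<odot>\<^bsub>A\<^esub> c1) \<otimes>\<^bsub>A\<^esub> (a2 \<odot>\<^bsub>A\<^esub> c2))"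
    using assms by (simp add: puig_elt_eq_p puig_mult_p)
  then show ?thesis
    using assms by (simp add: puig_elt_eq_p A.smult_mult_smult)
qed

end

section \<open>The interior structure under the fibre condition\<close>

locale puig_setup_normal = puig_setup +
  assumes fibre: "\<lbrakk>x \<in> Ob D; y \<in> Ob D; f \<in> hom_set D x y\<rbrakk>
      \<Longrightarrow> fibre_class D sm f = {cmp D g f | g. g \<in> Id_class D sm y}"
begin

lemma p_\<sigma>_fibre:
  assumes f: "f \<in> Mor D" and f': "f' \<in> Mor D" "sm f' = sm f"
  shows "p (\<sigma> (D.e f')) = p (\<sigma> (D.e f))"
proof -
  note ob = D.category_axioms(1,2)[OF f]
  have "f' \<in> fibre_class D sm f" using f' by (simp add: fibre_class_def)
  then obtain g where g: "g \<in> Id_class D sm (tgt D f)" "f' = cmp D g f"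
    using fibre[OF ob, of f] f by (auto simp: hom_set_def)
  let ?\<phi> = "(idt D)(tgt D f := g)"
  have \<phi>: "?\<phi> \<in> Id_choice" using g(1) idt_Id_class by simp
  then have S: "Id_sum ?\<phi> \<in> S" unfolding S_eq by (rule imageI)
  \<comment> \<open>By \<open>Id_sum_mult\<close> only the value of \<open>?\<phi>\<close> at the
    target of \<open>f\<close> enters the product, and that value is \<open>g\<close>.\<close>
  have "\<sigma> (D.e f') = \<sigma> (Id_sum ?\<phi> \<otimes>\<^bsub>D.alg\<^esub> D.e f)"
    using Id_sum_mult[OF \<phi> f] g(2) by simp
  also have "\<dots> = \<sigma> (Id_sum ?\<phi>) \<otimes>\<^bsub>A\<^esub> \<sigma> (D.e f)"
    using S S_closed D.e_closed[OF f] by (intro \<sigma>_mult) auto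
  finally show ?thesis
    using p_generator[OF S \<sigma>.hom_closed[OF D.e_closed[OF f]]] by simp
qed

lemma \<sigma>_basis_in_I:
  assumes f: "f \<in> Mor D"
  shows "\<sigma> (D.e f) \<in> I"
proof -
  have "p (\<sigma> (D.e f) \<otimes>\<^bsub>A\<^esub> \<sigma> s) = p (\<sigma> (D.e f))" if s: "s \<in> S" for s
  proof -
    obtain \<phi> where \<phi>: "\<phi> \<in> Id_choice" "s = Id_sum \<phi>" using s unfolding S_eq by blast
    define g where "g = \<phi> (src D f)"
    have gI: "g \<in> Id_class D sm (src D f)"
      using \<phi>(1) D.category_axioms(1)[OF f] by (simp add: g_def)
    note g = Id_class[OF D.category_axioms(1)[OF f] gI]
    have "\<sigma> (D.e f) \<otimes>\<^bsub>A\<^esub> \<sigma> s = \<sigma> (D.e f \<otimes>\<^bsub>D.alg\<^esub> s)"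
      using s S_closed D.e_closed[OF f] by (intro \<sigma>_mult[symmetric]) auto
    also have "\<dots> = \<sigma> (D.e (cmp D f g))"
      using mult_Id_sum[OF \<phi>(1) f] \<phi>(2) by (simp add: g_def)
    also have "p \<dots> = p (\<sigma> (D.e f))"
    proof (rule p_\<sigma>_fibre[OF f])
      show "cmp D f g \<in> Mor D" using f g by (intro D.category_axioms) auto
      \<comment> \<open>Functoriality: \<open>g\<close> lies over an identity, so composing with it
        does not change the image.\<close>
      show "sm (cmp D f g) = sm f"
        using f g C.category_axioms(9)[OF functor_simps(3)[OF f]] by (simp add: functor_simps)
    qed
    finally show ?thesis .
  qed
  then show ?thesis using \<sigma>.hom_closed[OF D.e_closed[OF f]] by (simp add: I_def)
qed

text \<open>Copied verbatim from the body of \<open>IndP_interior\<close>, so that it can be folded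
  there.\<close>

definition lift where
  "lift f' = (THE w. \<forall>f\<in>Mor D. sm f = f' \<longrightarrow> w = elt \<one> (\<sigma> (D.e f)))"

lemma lift_sm:
  assumes f: "f \<in> Mor D"
  shows "lift (sm f) = p (\<sigma> (D.e f))"
  unfolding lift_def
proof (rule the_equality)
  show "\<forall>f'\<in>Mor D. sm f' = sm f \<longrightarrow> p (\<sigma> (D.e f)) = elt \<one> (\<sigma> (D.e f'))"
    unfolding p_def[symmetric] by (intro ballI impI p_\<sigma>_fibre[OF f, symmetric])
  fix w
  assume w: "\<forall>f'\<in>Mor D. sm f' = sm f \<longrightarrow> w = elt \<one> (\<sigma> (D.e f'))"
  show "w = p (\<sigma> (D.e f))"
    unfolding p_def using bspec[OF w f] by (rule mp) (rule refl)
qed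

abbreviation "\<psi> \<equiv> IndP_interior K C D sm A \<sigma>"

lemma lift_closed: "lift \<in> Mor C \<rightarrow> p ` I"
proof
  fix f' assume "f' \<in> Mor C"
  then obtain f where f: "f \<in> Mor D" "f' = sm f" using surj_sm by blast
  show "lift f' \<in> p ` I"
    unfolding f(2) lift_sm[OF f(1)] by (intro imageI \<sigma>_basis_in_I f(1))
qed

lemma lift_closed_Q: "lift \<in> Mor C \<rightarrow> carrier Q"
proof
  fix f' assume "f' \<in> Mor C"
  then obtain c where "c \<in> I" "lift f' = p c" using funcset_mem[OF lift_closed] by blast
  then show "lift f' \<in> carrier Q" using p.hom_closed[OF I_closed] by simp
qed

text \<open>\<open>IndP_interior\<close> sums over all of \<open>Mor C\<close>,
  \<open>lin_ext\<close> over the support; the additional terms vanish.\<close>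

lemma \<psi>_eq_lin_ext:
  assumes "b \<in> carrier C.F"
  shows "\<psi> b = lin_ext K Q lift b"
  unfolding IndP_interior_def lift_def[symmetric]
  using Q.lin_ext_superset[OF assms lift_closed_Q C.finite_Mor] free_module_carrierD(2)[OF assms]
  by simp

lemma \<psi>_basis:
  assumes f: "f \<in> Mor D"
  shows "\<psi> (C.e (sm f)) = p (\<sigma> (D.e f))"
  using \<psi>_eq_lin_ext[OF C.e_closed] Q.lin_ext_basis_elt[OF lift_closed_Q]
    functor_simps(3)[OF f] lift_sm[OF f] by simp

lemma linear_map_\<psi>_Q: "linear_map K C.F Q \<psi>"
proof -
  interpret l: linear_map K C.F Q "lin_ext K Q lift"
    by (rule Q.linear_map_lin_ext[OF lift_closed_Q])
  show ?thesis
    by unfold_locales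
      (simp_all add: \<psi>_eq_lin_ext l.hom_closed l.hom_add l.hom_smult)
qed

text \<open>\<open>P\<close> has the operations of \<open>Q\<close> on a smaller carrier, so only
  the location of the values is at issue. The image of \<open>I\<close> is a submodule, and on basis
  elements the values lie in it by \<open>\<sigma>_basis_in_I\<close>.\<close>

lemma linear_map_\<psi>: "linear_map K C.F P \<psi>"
proof -
  interpret q: linear_map K C.F Q \<psi> by (rule linear_map_\<psi>_Q)
  interpret P: assoc_algebra K P by (rule assoc_algebra_IndP)
  have "carrier C.F \<subseteq> {b \<in> carrier C.F. \<psi> b \<in> p ` I}"
  proof (rule A.K.free_module_subset_submodule)
    show "submodule {b \<in> carrier C.F. \<psi> b \<in> p ` I} K C.F"
      by (rule q.vimage_submodule[OF p.image_submodule[OF I_submodule]])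
    fix f' assume "f' \<in> Mor C"
    then obtain f where f: "f \<in> Mor D" "f' = sm f" using surj_sm by blast
    show "C.e f' \<in> {b \<in> carrier C.F. \<psi> b \<in> p ` I}"
      using f C.e_closed \<psi>_basis \<sigma>_basis_in_I by (auto simp: functor_simps)
  qed
  then show ?thesis
    by unfold_locales (auto simp: IndP_simps(1-4) q.hom_add q.hom_smult)
qed

lemma \<psi>_mult:
  assumes "a \<in> carrier C.F" "b \<in> carrier C.F"
  shows "\<psi> (a \<otimes>\<^bsub>C.alg\<^esub> b) = \<psi> a \<otimes>\<^bsub>P\<^esub> \<psi> b"
proof (rule C.linear_map_multiplicativeI[OF assoc_algebra_IndP linear_map_\<psi> _ assms])
  fix g' f' assume "g' \<in> Mor C" "f' \<in> Mor C"
  then obtain g f where g: "g \<in> Mor D" "g' = sm g" and f: "f \<in> Mor D" "f' = sm f"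
    using surj_sm by blast
  \<comment> \<open>Injectivity of \<open>so\<close> reflects composability. Otherwise a product
    could vanish in kD while its counterpart in kC is a composite.\<close>
  have comp: "src C g' = tgt C f' \<longleftrightarrow> src D g = tgt D f"
    using inj_so D.category_axioms(1)[OF g(1)] D.category_axioms(2)[OF f(1)]
    by (auto simp: g f functor_simps dest: inj_onD)
  have "\<psi> (C.e g' \<otimes>\<^bsub>C.alg\<^esub> C.e f') = p (\<sigma> (D.e g \<otimes>\<^bsub>D.alg\<^esub> D.e f))"
  proof (cases "src D g = tgt D f")
    case True
    then have "C.e g' \<otimes>\<^bsub>C.alg\<^esub> C.e f' = C.e (sm (cmp D g f))"
      using C.basis_mult[of g' f'] comp f g by (simp add: functor_simps)
    then show ?thesis
      using True \<psi>_basis[of "cmp D g f"] D.basis_mult[OF g(1) f(1)] D.category_axioms(6) f g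
      by simp
  next
    case False
    then have "C.e g' \<otimes>\<^bsub>C.alg\<^esub> C.e f' = \<zero>\<^bsub>C.F\<^esub>"
      using C.basis_mult[of g' f'] comp f g by (simp add: functor_simps)
    then show ?thesis
      using False D.basis_mult[OF g(1) f(1)] linear_map.hom_zero[OF linear_map_\<psi>_Q]
        \<sigma>.hom_zero p.hom_zero by simp
  qed
  also have "\<dots> = p (\<sigma> (D.e g) \<otimes>\<^bsub>A\<^esub> \<sigma> (D.e f))"
    using f g by (simp add: \<sigma>_mult D.e_closed)
  also have "\<dots> = \<psi> (C.e g') \<otimes>\<^bsub>P\<^esub> \<psi> (C.e f')"
    using f g by (simp add: \<psi>_basis puig_mult_p \<sigma>_basis_in_I)
  finally show "\<psi> (C.e g' \<otimes>\<^bsub>C.alg\<^esub> C.e f') = \<psi> (C.e g') \<otimes>\<^bsub>P\<^esub> \<psi> (C.e f')" .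
qed

text \<open>\<open>so\<close> is a bijection on objects, so the identity of kC can be indexed by
  \<open>Ob D\<close>; it then corresponds term by term to the identity of kD, which
  \<open>\<sigma>\<close> sends to 1.\<close>

lemma \<psi>_one: "\<psi> \<one>\<^bsub>C.alg\<^esub> = \<one>\<^bsub>P\<^esub>"
proof -
  interpret \<psi>: linear_map K C.F Q \<psi> by (rule linear_map_\<psi>_Q)
  have id: "C.e (idt C x) \<in> carrier C.F" if "x \<in> Ob C" for x
    using that by (intro C.e_closed C.category_axioms)
  have idD: "D.e (idt D x) \<in> carrier D.F" if "x \<in> Ob D" for x
    using that by (intro D.e_closed D.category_axioms)
  have "\<psi> \<one>\<^bsub>C.alg\<^esub> = (\<Oplus>\<^bsub>Q\<^esub>x \<in> Ob C. \<psi> (C.e (idt C x)))"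
    unfolding category_algebra_one using id by (intro \<psi>.hom_finsum C.finite_Ob) auto
  also have "\<dots> = (\<Oplus>\<^bsub>Q\<^esub>x \<in> so ` Ob D. \<psi> (C.e (idt C x)))" by (simp only: so_image_Ob)
  also have "\<dots> = (\<Oplus>\<^bsub>Q\<^esub>x \<in> Ob D. \<psi> (C.e (idt C (so x))))"
    using id \<psi>.hom_closed by (intro Q.M.finsum_reindex inj_so) (auto simp: so_image_Ob)
  also have "\<dots> = (\<Oplus>\<^bsub>Q\<^esub>x \<in> Ob D. p (\<sigma> (D.e (idt D x))))"
  proof (rule Q.M.finsum_cong'[OF refl])
    show "(\<lambda>x. p (\<sigma> (D.e (idt D x)))) \<in> Ob D \<rightarrow> carrier Q"
      using idD \<sigma>.hom_closed p.hom_closed by auto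
    show "\<psi> (C.e (idt C (so x))) = p (\<sigma> (D.e (idt D x)))" if "x \<in> Ob D" for x
      using \<psi>_basis[OF D.category_axioms(3)[OF that]] that by (simp add: functor_simps)
  qed
  also have "\<dots> = p (\<sigma> (\<Oplus>\<^bsub>D.F\<^esub>x \<in> Ob D. D.e (idt D x)))"
    using idD
    by (intro linear_map.hom_finsum[OF linear_map_comp[OF \<sigma>.linear_map_axioms p.linear_map_axioms],
          symmetric] D.finite_Ob) auto
  finally show ?thesis by (simp only: \<sigma>_one IndP_simps(6))
qed

lemma interior_algebra_IndP: "interior_algebra K C.alg P \<psi>"
proof -
  interpret \<psi>: linear_map K C.F P \<psi> by (rule linear_map_\<psi>)
  show ?thesis
    unfolding interior_algebra_def algebra_hom_def ring_hom_def
    using assoc_algebra_IndP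
    by (simp add: \<psi>.hom_closed \<psi>.hom_add \<psi>.hom_smult \<psi>_mult \<psi>_one)
qed

end

theorem proposition4p5:
  fixes K :: "('k, 'e) ring_scheme"
    and \<C> :: "('p, 'n) category"
    and \<D> :: "('o, 'm) category"
    and so :: "'o \<Rightarrow> 'p" and sm :: "'m \<Rightarrow> 'n"
    and C :: "('k, 'a, 'f) module_scheme"
    and \<sigma> :: "('m \<Rightarrow> 'k) \<Rightarrow> 'a"
  assumes "field K"
    and "finite_category \<C>"
    and "finite_category \<D>"
    and "is_functor \<D> \<C> so sm"
    and "inj_on so (Ob \<D>)"
    and "sm ` Mor \<D> = Mor \<C>"
    and "interior_algebra K (category_algebra K \<D>) C \<sigma>"
  shows
    "(assoc_algebra K (IndP K \<D> sm C \<sigma>) \<and>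
      (\<forall>a1\<in>carrier K. \<forall>a2\<in>carrier K. \<forall>c1\<in>carrier C. \<forall>c2\<in>carrier C.
         puig_elt K \<D> sm C \<sigma> a1 c1 \<in> carrier (IndP K \<D> sm C \<sigma>) \<longrightarrow>
         puig_elt K \<D> sm C \<sigma> a2 c2 \<in> carrier (IndP K \<D> sm C \<sigma>) \<longrightarrow>
         puig_elt K \<D> sm C \<sigma> a1 c1 \<otimes>\<^bsub>IndP K \<D> sm C \<sigma>\<^esub> puig_elt K \<D> sm C \<sigma> a2 c2
           = puig_elt K \<D> sm C \<sigma> (a1 \<otimes>\<^bsub>K\<^esub> a2) (c1 \<otimes>\<^bsub>C\<^esub> c2)) \<and>
      \<one>\<^bsub>IndP K \<D> sm C \<sigma>\<^esub> = puig_elt K \<D> sm C \<sigma> \<one>\<^bsub>K\<^esub> \<one>\<^bsub>C\<^esub>)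
     \<and>
     ((\<forall>x\<in>Ob \<D>. \<forall>y\<in>Ob \<D>. \<forall>f\<in>hom_set \<D> x y.
         fibre_class \<D> sm f = {cmp \<D> g f | g. g \<in> Id_class \<D> sm y} \<and>
         {cmp \<D> g f | g. g \<in> Id_class \<D> sm y} = {cmp \<D> f g | g. g \<in> Id_class \<D> sm x}) \<longrightarrow>
      interior_algebra K (category_algebra K \<C>) (IndP K \<D> sm C \<sigma>)
         (IndP_interior K \<C> \<D> sm C \<sigma>) \<and>
      (\<forall>f\<in>Mor \<D>. IndP_interior K \<C> \<D> sm C \<sigma> (basis_elt K (sm f))
         = puig_elt K \<D> sm C \<sigma> \<one>\<^bsub>K\<^esub> (\<sigma> (basis_elt K f))))"
proof -
  interpret puig_setup K \<C> \<D> so sm C \<sigma>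
    by (rule puig_setup.intro) fact+
  have one: "\<one>\<^bsub>IndP K \<D> sm C \<sigma>\<^esub> = puig_elt K \<D> sm C \<sigma> \<one>\<^bsub>K\<^esub> \<one>\<^bsub>C\<^esub>"
    by (simp add: IndP_def)
  have normal: "interior_algebra K (category_algebra K \<C>) (IndP K \<D> sm C \<sigma>)
         (IndP_interior K \<C> \<D> sm C \<sigma>) \<and>
      (\<forall>f\<in>Mor \<D>. IndP_interior K \<C> \<D> sm C \<sigma> (basis_elt K (sm f))
         = puig_elt K \<D> sm C \<sigma> \<one>\<^bsub>K\<^esub> (\<sigma> (basis_elt K f)))"
    if fibres: "\<forall>x\<in>Ob \<D>. \<forall>y\<in>Ob \<D>. \<forall>f\<in>hom_set \<D> x y.
         fibre_class \<D> sm f = {cmp \<D> g f | g. g \<in> Id_class \<D> sm y} \<and>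
         {cmp \<D> g f | g. g \<in> Id_class \<D> sm y} = {cmp \<D> f g | g. g \<in> Id_class \<D> sm x}"
  proof -
    interpret puig_setup_normal K \<C> \<D> so sm C \<sigma>
      by unfold_locales (use fibres in blast)
    show ?thesis
      using interior_algebra_IndP \<psi>_basis unfolding p_def by blast
  qed
  show ?thesis
  proof (rule conjI, goal_cases)
    case 1
    show ?case by (intro conjI ballI impI assoc_algebra_IndP IndP_mult one)
  next
    case 2
    show ?case by (rule impI) (rule normal)
  qed
qed

end
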